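(* Let $V$ be a nonzero finite-dimensional real normed space that is not isometric to $\ell_\infty^d$ for any $d$. Then, for any $0<p<1$, almost every countable dense set $S\subset V$ is strongly non-Rado.
   Context: All normed spaces are finite-dimensional and real. $\ell_\infty^d$ is $\mathbb{R}^d$ with norm $\|(x_1,\dots,x_d)\|=\max_i|x_i|$. Random graph model: let $S$ be a countable dense subset of $V$ and let $\widehat{G}(V,S)$ be the graph on vertex set $S$ in which distinct $x,y\in S$ are joined if and only if $\|x-y\|<1$. For $0<p<1$, $\mathcal{G}_p(V,S)$ is the probability space of random subgraphs $G$ of $\widehat{G}(V,S)$ with vertex set $S$ in which each edge of $\widehat{G}(V,S)$ is kept independently with probability $p$. The set $S$ is strongly non-Rado (for $p$) if two independent random graphs $G,G'\in\mathcal{G}_p(V,S)$ are almost surely not isomorphic. $\ell_\infty$-decomposition: every finite-dimensional normed space $V$ has a unique maximal subspace $W$ isometric to $\ell_\infty^d$ for some $d\ge 0$ such that there is a subspace $U$ with $V=U\oplus W$ and $\|u+w\|=\max(\|u\|,\|w\|)$ for all $u\in U$, $w\in W$. One writes $V=(U\oplus\ell_\infty^d)_\infty$. "Almost every": this refers to any fixed notion of "almost all countable dense subsets of $V$" for which almost all $S$ satisfy the following genericity condition, writing $V=(U\oplus\ell_\infty^d)_\infty$: (if $U\neq\{0\}$) no two distinct points of $S$ have the same $U$-component, and (if $d\geq 1$) no two distinct points of $S$ have $\ell_\infty^d$-components differing by an integer (including $0$) in some coordinate. (As usual, if a property holds for almost all $S$ then so does any property it implies.) For example, one may take $S$ to be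 the set of points of an i.i.d. sequence sampled from a distribution on $V\cong\mathbb{R}^n$ with strictly positive density, with "almost every" meaning almost surely; or the union of countably many density-one Poisson processes. *)

theory Defs
  imports "HOL-Probability.Probability"
begin

section \<open>The spaces \<open>\<ell>\<^sub>\<infinity>\<^sup>d\<close>\<close>

text \<open>
  Since \<open>d\<close> is quantified inside formulas, \<open>\<real>\<^sup>d\<close> is modelled by the real sequences vanishing
  from index \<open>d\<close> on. The inserted \<open>0\<close> only matters for \<open>d = 0\<close>.
\<close>

definition linf_carrier :: "nat \<Rightarrow> (nat \<Rightarrow> real) set" where
  "linf_carrier d = {x. \<forall>i\<ge>d. x i = 0}"

definition linf_norm :: "nat \<Rightarrow> (nat \<Rightarrow> real) \<Rightarrow> real" where
  "linf_norm d x = Max (insert 0 ((\<lambda>i. \<bar>x i\<bar>) ` {..<d}))"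

text \<open>Isometries between normed spaces are understood to be linear.\<close>

definition linf_isometry :: "('a::real_normed_vector \<Rightarrow> nat \<Rightarrow> real) \<Rightarrow> 'a set \<Rightarrow> nat \<Rightarrow> bool" where
  "linf_isometry T W d \<longleftrightarrow>
     subspace W \<and>
     bij_betw T W (linf_carrier d) \<and>
     (\<forall>x\<in>W. \<forall>y\<in>W. \<forall>i. T (x + y) i = T x i + T y i) \<and>
     (\<forall>c. \<forall>x\<in>W. \<forall>i. T (c *\<^sub>R x) i = c * T x i) \<and>
     (\<forall>x\<in>W. linf_norm d (T x) = norm x)"

definition isometric_linf :: "'a::real_normed_vector set \<Rightarrow> nat \<Rightarrow> bool" where
  "isometric_linf W d \<longleftrightarrow> (\<exists>T. linf_isometry T W d)"


section \<open>The \<open>\<ell>\<^sub>\<infinity>\<close>-decomposition and genericity\<close>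

definition max_direct_sum :: "'a::real_normed_vector set \<Rightarrow> 'a set \<Rightarrow> bool" where
  "max_direct_sum U W \<longleftrightarrow>
     subspace U \<and> subspace W \<and> U \<inter> W = {0} \<and>
     (\<forall>x. \<exists>u\<in>U. \<exists>w\<in>W. x = u + w) \<and>
     (\<forall>u\<in>U. \<forall>w\<in>W. norm (u + w) = max (norm u) (norm w))"

definition linf_summand :: "'a::real_normed_vector set \<Rightarrow> bool" where
  "linf_summand W \<longleftrightarrow> (\<exists>d. isometric_linf W d) \<and> (\<exists>U. max_direct_sum U W)"

text \<open>
  \<open>T\<close> is the identification of the maximal summand \<open>W\<close> with \<open>\<ell>\<^sub>\<infinity>\<^sup>d\<close>; it supplies the coordinates
  used in the genericity condition.
\<close>

definition linf_decomposition ::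
    "'a::real_normed_vector set \<Rightarrow> 'a set \<Rightarrow> nat \<Rightarrow> ('a \<Rightarrow> nat \<Rightarrow> real) \<Rightarrow> bool" where
  "linf_decomposition U W d T \<longleftrightarrow>
     max_direct_sum U W \<and> linf_isometry T W d \<and>
     (\<forall>W'. linf_summand W' \<and> W \<subseteq> W' \<longrightarrow> W' = W)"

text \<open>
  \<open>U\<close>, \<open>W\<close> and \<open>d\<close> are determined by the space, and \<open>T\<close> is determined up to permutations and
  sign changes of the coordinates, which do not affect the condition below. Hence it makes no
  difference that the decomposition is quantified existentially.
\<close>

definition generic :: "'a::real_normed_vector set \<Rightarrow> bool" where
  "generic S \<longleftrightarrow>
     (\<exists>U W d T. linf_decomposition U W d T \<and>
        (\<forall>x\<in>S. \<forall>y\<in>S. x \<noteq> y \<longrightarrow>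
          (\<forall>u\<in>U. \<forall>w\<in>W. \<forall>u'\<in>U. \<forall>w'\<in>W. x = u + w \<and> y = u' + w' \<longrightarrow>
             (U \<noteq> {0} \<longrightarrow> u \<noteq> u') \<and>
             (\<forall>i<d. T w i - T w' i \<notin> \<int>))))"


section \<open>Random geometric graphs\<close>

definition geometric_edges :: "'a::real_normed_vector set \<Rightarrow> 'a set set" where
  "geometric_edges S = {{x, y} | x y. x \<in> S \<and> y \<in> S \<and> x \<noteq> y \<and> norm (x - y) < 1}"

text \<open>
  An outcome \<open>\<omega>\<close> tells for every edge of the full geometric graph whether it is kept. The
  coordinates are independent since the measure is a product measure.
\<close>

definition random_graph :: "real \<Rightarrow> 'a::real_normed_vector set \<Rightarrow> ('a set \<Rightarrow> bool) measure" where
  "random_graph p S = PiM (geometric_edges S) (\<lambda>_. measure_pmf (bernoulli_pmf p))"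

definition kept_edges :: "'a::real_normed_vector set \<Rightarrow> ('a set \<Rightarrow> bool) \<Rightarrow> 'a set set" where
  "kept_edges S \<omega> = {e \<in> geometric_edges S. \<omega> e}"

definition graph_isomorphic :: "'a set \<Rightarrow> 'a set set \<Rightarrow> 'b set \<Rightarrow> 'b set set \<Rightarrow> bool" where
  "graph_isomorphic V E V' E' \<longleftrightarrow>
     (\<exists>f. bij_betw f V V' \<and> (\<forall>x\<in>V. \<forall>y\<in>V. {x, y} \<in> E \<longleftrightarrow> {f x, f y} \<in> E'))"

definition strongly_non_Rado :: "real \<Rightarrow> 'a::real_normed_vector set \<Rightarrow> bool" where
  "strongly_non_Rado p S \<longleftrightarrow>
     (AE (\<omega>, \<omega>') in random_graph p S \<Otimes>\<^sub>M random_graph p S.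
        \<not> graph_isomorphic S (kept_edges S \<omega>) S (kept_edges S \<omega>'))"


section \<open>Almost every countable dense set\<close>

text \<open>
  A notion of ``almost every'' is a quantifier over properties of countable dense sets. It only
  has to be closed under implication between such properties and to hold of genericity.
\<close>

definition almost_every_notion :: "(('a::real_normed_vector set \<Rightarrow> bool) \<Rightarrow> bool) \<Rightarrow> bool" where
  "almost_every_notion almost_every \<longleftrightarrow>
     (\<forall>P Q. (\<forall>S. countable S \<and> closure S = UNIV \<and> P S \<longrightarrow> Q S) \<longrightarrow>
        almost_every P \<longrightarrow> almost_every Q) \<and>
     almost_every generic"

end

theory Submission
  imports Defs
begin

text \<open>
  Almost surely, any two points at distance less than 2 have a common neighbour, whereas two
  neighbours of a point are at distance less than 2. So an isomorphism \<open>f\<close> between two of the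
  random graphs is a ``step map'': a bijection of \<open>S\<close> with
  \<open>norm (x - y) < 2 \<longleftrightarrow> norm (f x - f y) < 2\<close>. The heart of the matter is that, outside
  \<open>\<ell>\<^sub>\<infinity>\<^sup>d\<close>, a generic \<open>S\<close> has only countably many step maps (\<open>countable_step_maps\<close>). For one fixed bijection, being an isomorphism
  prescribes infinitely many independent coins and has probability 0 (\<open>AE_not_isomorphism\<close>), and
  a countable union of null events is null.

  For the rigidity of step maps, chains of steps show that a step map \<open>k\<close> preserves each of the relations
  \<open>norm (x - y) < n * r\<close>; hence it distorts distances by at most \<open>r\<close>. Blowing down, \<open>k (n x) / n\<close>
  has a cluster point \<open>T\<close>, which is a bijective isometry fixing 0 and therefore linear
  (\<open>Mazur_Ulam\<close>). Let \<open>\<phi>\<close> be the derivative of the norm at a smooth point \<open>v\<close>, and put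
  \<open>\<phi>' = \<phi> \<circ> T\<inverse>\<close>, the derivative at \<open>T v\<close>. Seen from a point far out in direction \<open>-v\<close>, distances are
  \<open>\<phi>\<close> plus a constant, and \<open>k\<close> sends this far point far out in direction \<open>- T v\<close>. Since the comparison
  of distances with multiples of \<open>r\<close> is preserved, \<open>\<phi>' (k x) = h (\<phi> x)\<close> for a continuous monotone
  function \<open>h\<close> that respects shifts by multiples of \<open>r\<close> (\<open>step_map_functional_factors\<close>).

  A linear relation between \<open>\<phi>\<close> and other smooth functionals, in which at least two of these take part,
  is inherited by the functions \<open>h\<close>. This makes \<open>h\<close> additive up to a constant, hence a translation
  (\<open>step_map_functional_translation\<close>). A smooth functional \<open>\<phi>\<close> without such a relation splits off
  a coordinate line: some \<open>e\<close> is seen only by \<open>\<phi>\<close> and \<open>-\<phi>\<close>, and as the norm is the supremum of the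
  smooth functionals, this line is an \<open>\<ell>\<^sub>\<infinity>\<close>-direction
  (\<open>isolated_functional_enlarges_summand\<close>). By maximality of the summand \<open>W\<close>, all such lines lie in
  \<open>W\<close>, so every smooth functional that vanishes on \<open>W\<close> sees \<open>k\<close> as a translation.

  If now \<open>k\<close> fixes a finite set whose differences span those of \<open>S\<close>, then these translations are
  trivial and \<open>k x - x \<in> W\<close> for all \<open>x\<close>. The space is not \<open>\<ell>\<^sub>\<infinity>\<^sup>d\<close>, so the complement \<open>U\<close> is nonzero, and
  genericity says that different points of \<open>S\<close> have different \<open>U\<close>-components: \<open>k\<close> is the identity. Applied to
  \<open>g\<inverse> \<circ> f\<close>, this shows that a step map is determined by its values on a finite set, and there are
  only countably many possible values.
\<close>

section \<open>Finite-dimensional normed spaces\<close>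

text \<open>
  Coordinates with respect to a finite independent set are bounded. In the induction step the new
  vector \<open>b\<close> has positive distance from the span of the others: otherwise a sequence in this span
  converges to \<open>b\<close>, its coordinates are Cauchy by the induction hypothesis, and \<open>b\<close> would lie in the
  span.
\<close>

lemma norm_coordinates_le:
  fixes B :: "'a::real_normed_vector set"
  assumes "finite B" "independent B"
  shows "\<exists>C>0. \<forall>c. (\<Sum>b\<in>B. \<bar>c b\<bar>) \<le> C * norm (\<Sum>b\<in>B. c b *\<^sub>R b)"
  using assms
proof (induction B rule: finite_induct)
  case empty
  show ?case by (auto intro!: exI[of _ 1])
next
  case (insert b B)
  have indB: "independent B" and b: "b \<notin> span B"
    using insert.prems insert.hyps by (auto simp: independent_insert)
  obtain C where C: "C > 0" "\<And>c. (\<Sum>b\<in>B. \<bar>c b\<bar>) \<le> C * norm (\<Sum>b\<in>B. c b *\<^sub>R b)"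
    using insert.IH[OF indB] by blast
  have "\<exists>\<delta>>0. \<forall>y\<in>span B. \<delta> \<le> norm (b - y)"
  proof (rule ccontr)
    assume "\<not> ?thesis"
    then have "\<forall>n. \<exists>y\<in>span B. norm (b - y) < inverse (real (Suc n))"
      by (meson inverse_positive_iff_positive not_le of_nat_0_less_iff zero_less_Suc)
    then obtain y where y: "\<And>n. y n \<in> span B" "\<And>n. norm (b - y n) < inverse (real (Suc n))"
      by metis
    have "\<forall>n. \<exists>c. y n = (\<Sum>v\<in>B. c v *\<^sub>R v)"
      using y(1) span_finite[OF insert.hyps(1)] by auto
    then obtain c where c: "\<And>n. y n = (\<Sum>v\<in>B. c n v *\<^sub>R v)" by metis
    have "(\<lambda>n. b - y n) \<longlonglongrightarrow> 0"
      by (rule LIMSEQ_norm_0) (use y(2) in \<open>simp add: inverse_eq_divide\<close>)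
    then have ylim: "y \<longlonglongrightarrow> b"
      using tendsto_diff[OF tendsto_const[of b]] by force
    have coord: "convergent (\<lambda>n. c n v)" if "v \<in> B" for v
    proof -
      have "Cauchy (\<lambda>n. c n v)"
      proof (rule CauchyI)
        fix e :: real assume "e > 0"
        then have "e / C > 0" using C by simp
        then obtain M where M: "\<And>m n. m \<ge> M \<Longrightarrow> n \<ge> M \<Longrightarrow> norm (y m - y n) < e / C"
          using LIMSEQ_imp_Cauchy[OF ylim] CauchyD by metis
        have "norm (c m v - c n v) < e" if "m \<ge> M" "n \<ge> M" for m n
        proof -
          have "\<bar>c m v - c n v\<bar> \<le> (\<Sum>v\<in>B. \<bar>c m v - c n v\<bar>)"
            using insert.hyps(1) \<open>v \<in> B\<close> by (intro member_le_sum) auto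
          also have "\<dots> \<le> C * norm (y m - y n)"
            using C(2)[of "\<lambda>v. c m v - c n v"] by (simp add: c sum_subtractf scaleR_diff_left)
          also have "\<dots> < C * (e / C)"
            using M[OF that] C(1) by (intro mult_strict_left_mono) auto
          finally show ?thesis using C(1) by simp
        qed
        then show "\<exists>M. \<forall>m\<ge>M. \<forall>n\<ge>M. norm (c m v - c n v) < e" by blast
      qed
      then show ?thesis by (simp add: real_Cauchy_convergent)
    qed
    have "y \<longlonglongrightarrow> (\<Sum>v\<in>B. lim (\<lambda>n. c n v) *\<^sub>R v)"
      unfolding c[abs_def]
      using coord by (intro tendsto_sum tendsto_scaleR tendsto_const) (simp add: convergent_LIMSEQ_iff)
    then have "b = (\<Sum>v\<in>B. lim (\<lambda>n. c n v) *\<^sub>R v)"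
      using ylim LIMSEQ_unique by blast
    then show False
      using b by (metis (no_types, lifting) span_sum span_scale span_base)
  qed
  then obtain \<delta> where \<delta>: "\<delta> > 0" "\<And>y. y \<in> span B \<Longrightarrow> \<delta> \<le> norm (b - y)" by blast
  have "(\<Sum>v\<in>insert b B. \<bar>c v\<bar>) \<le> (1 / \<delta> + C + C * norm b / \<delta>) * norm (\<Sum>v\<in>insert b B. c v *\<^sub>R v)"
    for c
  proof -
    define y where "y = (\<Sum>v\<in>B. c v *\<^sub>R v)"
    define z where "z = c b *\<^sub>R b + y"
    have ysp: "y \<in> span B" unfolding y_def by (intro span_sum span_scale span_base)
    have cb: "\<bar>c b\<bar> * \<delta> \<le> norm z"
    proof (cases "c b = 0")
      case False
      have "\<delta> \<le> norm (b - (- inverse (c b)) *\<^sub>R y)"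
        using \<delta>(2) ysp span_scale by blast
      then have "\<bar>c b\<bar> * \<delta> \<le> norm (c b *\<^sub>R (b - (- inverse (c b)) *\<^sub>R y))"
        by (simp add: mult_left_mono)
      then show ?thesis using False by (simp add: z_def scaleR_add_right)
    qed simp
    then have cb': "\<bar>c b\<bar> \<le> norm z / \<delta>" using \<delta>(1) by (simp add: field_simps)
    have "norm y \<le> norm z + \<bar>c b\<bar> * norm b"
      using norm_triangle_ineq4[of z "c b *\<^sub>R b"] by (simp add: z_def)
    also have "\<dots> \<le> norm z + norm z / \<delta> * norm b"
      using cb' by (intro add_left_mono mult_right_mono) auto
    finally have "C * norm y \<le> C * (norm z + norm z / \<delta> * norm b)"
      using C(1) by simp
    with C(2)[of c] cb' have "\<bar>c b\<bar> + (\<Sum>v\<in>B. \<bar>c v\<bar>) \<le> norm z / \<delta> + C * (norm z + norm z / \<delta> * norm b)"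
      unfolding y_def by linarith
    then show ?thesis
      using insert.hyps by (simp add: z_def y_def algebra_simps)
  qed
  moreover have "1 / \<delta> + C + C * norm b / \<delta> > 0"
    using \<delta>(1) C(1) by (simp add: add_pos_nonneg)
  ultimately show ?case by blast
qed

lemma finite_dim_basis:
  assumes "\<exists>B :: 'a::real_normed_vector set. finite B \<and> span B = UNIV"
  obtains B :: "'a::real_normed_vector set" where "finite B" "independent B" "span B = UNIV"
proof -
  obtain B0 :: "'a set" where "finite B0" "span B0 = UNIV" using assms by blast
  moreover obtain B where "B \<subseteq> B0" "independent B" "B0 \<subseteq> span B"
    using maximal_independent_subset[of B0] by blast
  ultimately show ?thesis
    using that by (metis finite_subset span_minimal subspace_span top.extremum_unique)
qed

text \<open>
  By boundedness of coordinates the ball lies in the continuous image of a cube.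
\<close>

lemma compact_cball_finite_dim:
  fixes a :: "'a::real_normed_vector"
  assumes fd: "\<exists>B :: 'a set. finite B \<and> span B = UNIV"
  shows "compact (cball a R)"
proof -
  obtain B :: "'a set" where B: "finite B" "independent B" "span B = UNIV"
    using finite_dim_basis[OF fd] .
  obtain C where C: "C > 0" "\<And>c. (\<Sum>b\<in>B. \<bar>c b\<bar>) \<le> C * norm (\<Sum>b\<in>B. c b *\<^sub>R b)"
    using norm_coordinates_le[OF B(1,2)] by blast
  define R' where "R' = C * (norm a + \<bar>R\<bar>)"
  define K where "K = PiE UNIV (\<lambda>b::'a. if b \<in> B then {-R'..R'} else {0::real})"
  define F where "F = (\<lambda>c::'a \<Rightarrow> real. \<Sum>b\<in>B. c b *\<^sub>R b)"
  have "compactin (product_topology (\<lambda>_. euclidean) UNIV) K"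
    unfolding K_def compactin_PiE by auto
  then have "compact K"
    by (simp add: euclidean_product_topology)
  moreover have "continuous_on K F"
    unfolding F_def
    by (intro continuous_intros continuous_on_product_then_coordinatewise[OF continuous_on_id])
  ultimately have cF: "compact (F ` K)" by (rule compact_continuous_image[rotated])
  have "cball a R \<subseteq> F ` K"
  proof
    fix x assume "x \<in> cball a R"
    then have nx: "norm x \<le> norm a + \<bar>R\<bar>"
      using norm_triangle_ineq2[of x a] by (simp add: dist_norm norm_minus_commute)
    have "x \<in> range (\<lambda>c. \<Sum>b\<in>B. c b *\<^sub>R b)"
      using B(3) unfolding span_finite[OF B(1)] by simp
    then obtain c where c: "x = (\<Sum>b\<in>B. c b *\<^sub>R b)"
      by blast
    define c' where "c' = (\<lambda>b. if b \<in> B then c b else 0)"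
    have "\<bar>c b\<bar> \<le> R'" if "b \<in> B" for b
    proof -
      have "\<bar>c b\<bar> \<le> (\<Sum>b\<in>B. \<bar>c b\<bar>)" using B(1) that by (intro member_le_sum) auto
      also have "\<dots> \<le> C * norm x" using C(2) c by blast
      also have "\<dots> \<le> R'" unfolding R'_def using nx C(1) by simp
      finally show ?thesis .
    qed
    then have "c' \<in> K" unfolding K_def c'_def by fastforce
    moreover have "F c' = x" unfolding F_def c'_def c by (intro sum.cong) auto
    ultimately show "x \<in> F ` K" by blast
  qed
  then show ?thesis
    using compact_Int_closed[OF cF closed_cball, of a R] by (simp add: Int_absorb1)
qed

text \<open>
  An auxiliary Euclidean structure. Its square is a smooth function of quadratic growth, used to
  find smooth points of the norm.
\<close>

lemma equivalent_inner_product: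
  assumes fd: "\<exists>B :: 'a::real_normed_vector set. finite B \<and> span B = UNIV"
  shows "\<exists>(G :: 'a::real_normed_vector \<Rightarrow> 'a \<Rightarrow> real) D K. (\<forall>x y. G x y = G y x) \<and> (\<forall>x. linear (G x)) \<and>
    D > 0 \<and> K > 0 \<and> (\<forall>x. (norm x)\<^sup>2 \<le> D * G x x) \<and> (\<forall>x. G x x \<le> K * (norm x)\<^sup>2) \<and>
    continuous_on UNIV (\<lambda>x. G x x)"
proof -
  obtain B :: "'a set" where B: "finite B" "independent B" "span B = UNIV"
    using finite_dim_basis[OF fd] .
  obtain C where C: "C > 0" "\<And>c. (\<Sum>b\<in>B. \<bar>c b\<bar>) \<le> C * norm (\<Sum>b\<in>B. c b *\<^sub>R b)"
    using norm_coordinates_le[OF B(1,2)] by blast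
  define r where "r = representation B"
  have rep: "x = (\<Sum>b\<in>B. r x b *\<^sub>R b)" for x
    unfolding r_def using B by (simp add: sum_representation_eq)
  have radd: "r (x + y) b = r x b + r y b" and rscale: "r (c *\<^sub>R x) b = c * r x b" for x y b c
    unfolding r_def using B by (simp_all add: representation_add representation_scale)
  have rC: "\<bar>r x b\<bar> \<le> C * norm x" if "b \<in> B" for x b
  proof -
    have "\<bar>r x b\<bar> \<le> (\<Sum>b\<in>B. \<bar>r x b\<bar>)" using B(1) that by (intro member_le_sum) auto
    also have "\<dots> \<le> C * norm x" using C(2)[of "r x"] rep[of x] by simp
    finally show ?thesis .
  qed
  define G where "G x y = (\<Sum>b\<in>B. r x b * r y b)" for x y
  define M where "M = (\<Sum>b\<in>B. (norm b)\<^sup>2)"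
  show ?thesis
  proof (rule exI[of _ G], rule exI[of _ "M + 1"], rule exI[of _ "real (card B) * C\<^sup>2 + 1"],
      intro conjI allI)
    show "G x y = G y x" for x y by (simp add: G_def mult.commute)
    show "linear (G x)" for x
      by (rule linearI) (simp_all add: G_def radd rscale sum.distrib sum_distrib_left algebra_simps)
    show "M + 1 > 0" unfolding M_def by (simp add: add_nonneg_pos sum_nonneg)
    show "real (card B) * C\<^sup>2 + 1 > 0" by (simp add: add_nonneg_pos)
    show "(norm x)\<^sup>2 \<le> (M + 1) * G x x" for x
    proof -
      have "norm x \<le> (\<Sum>b\<in>B. \<bar>r x b\<bar> * norm b)"
        by (subst rep) (rule norm_sum[THEN order_trans], simp)
      then have "(norm x)\<^sup>2 \<le> (\<Sum>b\<in>B. \<bar>r x b\<bar> * norm b)\<^sup>2"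
        by (intro power_mono) auto
      also have "\<dots> \<le> (\<Sum>b\<in>B. \<bar>r x b\<bar>\<^sup>2) * (\<Sum>b\<in>B. (norm b)\<^sup>2)"
        by (rule Cauchy_Schwarz_ineq_sum)
      also have "\<dots> = M * G x x" by (simp add: M_def G_def power2_eq_square)
      also have "\<dots> \<le> (M + 1) * G x x"
        by (intro mult_right_mono) (auto simp: G_def sum_nonneg)
      finally show ?thesis .
    qed
    show "G x x \<le> (real (card B) * C\<^sup>2 + 1) * (norm x)\<^sup>2" for x
    proof -
      have "r x b * r x b \<le> (C * norm x)\<^sup>2" if "b \<in> B" for b
        using power_mono[OF rC[OF that] abs_ge_zero, of x 2] by (simp add: power2_eq_square)
      then have "G x x \<le> real (card B) * (C * norm x)\<^sup>2"
        unfolding G_def by (intro sum_bounded_above)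
      also have "\<dots> \<le> (real (card B) * C\<^sup>2 + 1) * (norm x)\<^sup>2"
        by (simp add: power_mult_distrib algebra_simps)
      finally show ?thesis .
    qed
    have "bounded_linear (\<lambda>x. r x b)" if "b \<in> B" for b
      by (rule bounded_linear_intro[of _ C])
         (use rC[OF that] in \<open>simp_all add: radd rscale mult.commute\<close>)
    then have "continuous_on UNIV (\<lambda>x. r x b)" if "b \<in> B" for b
      using that linear_continuous_on by blast
    then show "continuous_on UNIV (\<lambda>x. G x x)"
      unfolding G_def by (intro continuous_intros) auto
  qed
qed

section \<open>Smooth points of the norm and their supporting functionals\<close>

text \<open>
  Differentiability of the norm at \<open>v\<close> with derivative \<open>\<phi>\<close>, in the strong form of a quadratic upper
  bound for the remainder. A lower bound is automatic by convexity, see \<open>smooth_at_support\<close>.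
\<close>

definition smooth_at :: "'a::real_normed_vector \<Rightarrow> ('a \<Rightarrow> real) \<Rightarrow> bool" where
  "smooth_at v \<phi> \<longleftrightarrow> v \<noteq> 0 \<and> linear \<phi> \<and> (\<exists>C. \<forall>h. norm (v + h) \<le> norm v + \<phi> h + C * (norm h)\<^sup>2)"

definition smooth_functionals :: "('a::real_normed_vector \<Rightarrow> real) set" where
  "smooth_functionals = {\<phi>. \<exists>v. smooth_at v \<phi>}"

lemma smooth_atE:
  assumes "smooth_at v \<phi>"
  obtains C where "C > 0" "\<And>h. norm (v + h) \<le> norm v + \<phi> h + C * (norm h)\<^sup>2"
proof -
  obtain C where "\<And>h. norm (v + h) \<le> norm v + \<phi> h + C * (norm h)\<^sup>2"
    using assms unfolding smooth_at_def by blast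
  moreover have "C * (norm h)\<^sup>2 \<le> (\<bar>C\<bar> + 1) * (norm h)\<^sup>2" for h :: 'a
    by (intro mult_right_mono) auto
  ultimately have "\<And>h. norm (v + h) \<le> norm v + \<phi> h + (\<bar>C\<bar> + 1) * (norm h)\<^sup>2"
    by (meson add_left_mono order_trans)
  then show ?thesis using that[of "\<bar>C\<bar> + 1"] by simp
qed

lemma smooth_at_linear: "smooth_at v \<phi> \<Longrightarrow> linear \<phi>"
  by (simp add: smooth_at_def)

text \<open>
  The point \<open>v\<close> is a convex combination of \<open>v + h\<close> and \<open>v - t h\<close>. Convexity and the upper
  bound at \<open>v - t h\<close> give the claim up to an error of order \<open>t\<close>.
\<close>

lemma smooth_at_support:
  assumes "smooth_at v \<phi>"
  shows "\<phi> h \<le> norm (v + h) - norm v"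
proof (rule field_le_epsilon)
  fix e :: real assume e: "e > 0"
  obtain C where C: "C > 0" "\<And>h. norm (v + h) \<le> norm v + \<phi> h + C * (norm h)\<^sup>2"
    using smooth_atE[OF assms] by blast
  interpret linear \<phi> using assms by (rule smooth_at_linear)
  define t where "t = e / (C * ((norm h)\<^sup>2 + 1))"
  have t: "t > 0" unfolding t_def using e C(1) by (simp add: add_nonneg_pos)
  have "C * t * (norm h)\<^sup>2 \<le> C * t * ((norm h)\<^sup>2 + 1)"
    using t C(1) by (intro mult_left_mono) auto
  also have "\<dots> = e"
    unfolding t_def using C(1) by (simp add: field_simps add_nonneg_eq_0_iff)
  finally have te: "C * t * (norm h)\<^sup>2 \<le> e" .
  have "(1 + t) * norm v = norm (t *\<^sub>R (v + h) + (v + (- t) *\<^sub>R h))"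
  proof -
    have "t *\<^sub>R (v + h) + (v + (- t) *\<^sub>R h) = (1 + t) *\<^sub>R v" by (simp add: algebra_simps)
    then show ?thesis using t by simp
  qed
  also have "\<dots> \<le> norm (t *\<^sub>R (v + h)) + norm (v + (- t) *\<^sub>R h)" by (rule norm_triangle_ineq)
  also have "norm (t *\<^sub>R (v + h)) = t * norm (v + h)" using t by simp
  also have "norm (v + (- t) *\<^sub>R h) \<le> norm v + \<phi> ((- t) *\<^sub>R h) + C * (norm ((- t) *\<^sub>R h))\<^sup>2"
    by (rule C(2))
  also have "\<dots> = norm v - t * \<phi> h + t * (C * t * (norm h)\<^sup>2)"
    unfolding scale by (simp add: power2_eq_square)
  also have "\<dots> \<le> norm v - t * \<phi> h + t * e" using te t by simp
  finally have "t * \<phi> h \<le> t * (norm (v + h) - norm v + e)" by (simp add: algebra_simps)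
  then show "\<phi> h \<le> norm (v + h) - norm v + e" using t by simp
qed

lemma smooth_at_le_norm:
  assumes "smooth_at v \<phi>" shows "\<phi> h \<le> norm h"
  using smooth_at_support[OF assms, of h] norm_triangle_ineq[of v h] by linarith

lemma smooth_at_abs_le_norm:
  assumes "smooth_at v \<phi>" shows "\<bar>\<phi> h\<bar> \<le> norm h"
  using smooth_at_le_norm[OF assms, of h] smooth_at_le_norm[OF assms, of "- h"]
    linear_neg[OF smooth_at_linear[OF assms], of h] by simp

lemma smooth_at_self:
  assumes "smooth_at v \<phi>" shows "\<phi> v = norm v"
proof -
  have "\<phi> (- v) \<le> norm (v + - v) - norm v" by (rule smooth_at_support[OF assms])
  then show ?thesis
    using smooth_at_le_norm[OF assms, of v] linear_neg[OF smooth_at_linear[OF assms], of v] by simp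
qed

lemma smooth_at_scale:
  assumes "smooth_at v \<phi>" "c > 0" shows "smooth_at (c *\<^sub>R v) \<phi>"
proof -
  obtain C where C: "C > 0" "\<And>h. norm (v + h) \<le> norm v + \<phi> h + C * (norm h)\<^sup>2"
    using smooth_atE[OF assms(1)] by blast
  interpret linear \<phi> using assms(1) by (rule smooth_at_linear)
  have "norm (c *\<^sub>R v + h) \<le> norm (c *\<^sub>R v) + \<phi> h + (C / c) * (norm h)\<^sup>2" for h
  proof -
    have "norm (c *\<^sub>R v + h) = c * norm (v + (1 / c) *\<^sub>R h)"
    proof -
      have "c *\<^sub>R v + h = c *\<^sub>R (v + (1 / c) *\<^sub>R h)" using assms(2) by (simp add: scaleR_add_right)
      then show ?thesis using assms(2) by (metis abs_of_pos norm_scaleR)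
    qed
    also have "\<dots> \<le> c * (norm v + \<phi> ((1 / c) *\<^sub>R h) + C * (norm ((1 / c) *\<^sub>R h))\<^sup>2)"
      by (rule mult_left_mono[OF C(2)]) (use assms(2) in simp)
    also have "\<dots> = norm (c *\<^sub>R v) + \<phi> h + (C / c) * (norm h)\<^sup>2"
      unfolding scale using assms(2) by (simp add: power2_eq_square field_simps)
    finally show ?thesis .
  qed
  moreover have "c *\<^sub>R v \<noteq> 0" "linear \<phi>" using assms unfolding smooth_at_def by auto
  ultimately show ?thesis unfolding smooth_at_def by blast
qed

lemma smooth_at_isometry:
  assumes "smooth_at v \<phi>" "linear T" "\<And>x. norm (T x) = norm x" "\<And>x. T (T' x) = x" "\<And>x. T' (T x) = x"
  shows "smooth_at (T v) (\<lambda>x. \<phi> (T' x))"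
proof -
  interpret T: linear T by fact
  have T': "linear T'"
  proof (rule linearI)
    show "T' (x + y) = T' x + T' y" for x y
      by (metis T.add assms(4,5))
    show "T' (c *\<^sub>R x) = c *\<^sub>R T' x" for c x
      by (metis T.scale assms(4,5))
  qed
  obtain C where C: "\<And>h. norm (v + h) \<le> norm v + \<phi> h + C * (norm h)\<^sup>2"
    using smooth_atE[OF assms(1)] by blast
  have "norm (T v + h) \<le> norm (T v) + \<phi> (T' h) + C * (norm h)\<^sup>2" for h
    using C[of "T' h"] assms(3)[of "T' h"] assms(3)[of "v + T' h"] assms(3)[of v]
    by (simp add: T.add assms(4))
  moreover have "linear (\<lambda>x. \<phi> (T' x))"
    using linear_compose[OF T' smooth_at_linear[OF assms(1)]] by (simp add: comp_def)
  moreover have "T v \<noteq> 0" using assms(1,3) by (metis norm_eq_zero smooth_at_def)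
  ultimately show ?thesis unfolding smooth_at_def by blast
qed

text \<open>
  A function that is touched from above by a smooth function and is convex is differentiable at the
  point of contact. Such a point arises near \<open>x0\<close> as a maximum of \<open>norm x - C * q (x - x0)\<close>, where \<open>q\<close>
  is the square of a Euclidean norm and \<open>C\<close> is large.
\<close>

lemma smooth_points_dense:
  fixes x0 :: "'a::real_normed_vector"
  assumes fd: "\<exists>B :: 'a set. finite B \<and> span B = UNIV" and "x0 \<noteq> 0" "e > 0"
  shows "\<exists>v \<phi>. smooth_at v \<phi> \<and> norm (v - x0) < e"
proof -
  obtain G :: "'a \<Rightarrow> 'a \<Rightarrow> real" and D K where
    G: "\<And>x y. G x y = G y x" "\<And>x. linear (G x)" "D > 0" "K > 0"
    "\<And>x. (norm x)\<^sup>2 \<le> D * G x x" "\<And>x. G x x \<le> K * (norm x)\<^sup>2"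
    "continuous_on UNIV (\<lambda>x. G x x)"
    using equivalent_inner_product[OF fd] by blast
  define d where "d = min e (norm x0) / 2"
  have d: "d > 0" "d < e" "d < norm x0" using assms(2,3) by (auto simp: d_def min_def)
  \<comment> \<open>With this factor the quadratic term beats the growth of the norm outside the ball of radius \<open>d\<close>.\<close>
  define C where "C = D / d"
  have C: "C > 0" using d G(3) by (simp add: C_def)
  define F where "F x = norm x - C * G (x - x0) (x - x0)" for x
  have "continuous_on (cball x0 d) F"
    unfolding F_def
    by (intro continuous_intros continuous_on_compose2[OF G(7), of _ "\<lambda>x. x - x0"]) auto
  then obtain v where v: "v \<in> cball x0 d" "\<And>x. x \<in> cball x0 d \<Longrightarrow> F x \<le> F v"
    using continuous_attains_sup[OF compact_cball_finite_dim[OF fd, of x0 d]] d(1) by fastforce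
  have lin0: "G x 0 = 0" for x using G(2) linear_0 by blast
  have max: "F x \<le> F v" for x
  proof (cases "x \<in> cball x0 d")
    case False
    then have far: "norm (x - x0) > d" by (simp add: dist_norm norm_minus_commute)
    have "norm (x - x0) * d \<le> norm (x - x0) * norm (x - x0)" using far by (intro mult_left_mono) auto
    also have "\<dots> \<le> D * G (x - x0) (x - x0)" using G(5)[of "x - x0"] by (simp add: power2_eq_square)
    finally have "norm (x - x0) \<le> C * G (x - x0) (x - x0)" using d(1) by (simp add: C_def field_simps)
    moreover have "norm x \<le> norm x0 + norm (x - x0)" using norm_triangle_sub by blast
    ultimately have "F x \<le> norm x0" unfolding F_def by linarith
    also have "\<dots> = F x0" by (simp add: F_def lin0)
    also have "\<dots> \<le> F v" using v(2) d(1) by simp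
    finally show ?thesis .
  qed (use v in auto)
  define \<phi> where "\<phi> h = 2 * C * G (v - x0) h" for h
  have "norm (v + h) \<le> norm v + \<phi> h + (C * K) * (norm h)\<^sup>2" for h
  proof -
    have "G (v + h - x0) (v + h - x0) = G (v - x0) (v - x0) + 2 * G (v - x0) h + G h h"
    proof -
      have "v + h - x0 = (v - x0) + h" by simp
      then show ?thesis
        using linear_add[OF G(2)] G(1) by (smt (verit))
    qed
    then have "norm (v + h) \<le> norm v + C * (2 * G (v - x0) h + G h h)"
      using max[of "v + h"] unfolding F_def by (simp add: algebra_simps)
    also have "\<dots> \<le> norm v + C * (2 * G (v - x0) h + K * (norm h)\<^sup>2)"
      using G(6)[of h] C by simp
    finally show ?thesis by (simp add: \<phi>_def algebra_simps)
  qed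
  moreover have "linear \<phi>"
    unfolding \<phi>_def
    by (rule linearI) (simp_all add: linear_add[OF G(2)] linear_scale[OF G(2)] algebra_simps)
  moreover have "v \<noteq> 0" using v(1) d(3) by (auto simp: dist_norm)
  ultimately have "smooth_at v \<phi>" unfolding smooth_at_def by blast
  moreover have "norm (v - x0) < e" using v(1) d(2) by (simp add: dist_norm norm_minus_commute)
  ultimately show ?thesis by blast
qed

text \<open>
  So the functional of a smooth point close to \<open>x\<close> almost attains its norm at \<open>x\<close>.
\<close>

lemma smooth_near_value:
  assumes "smooth_at v \<phi>" shows "norm x - 2 * norm (v - x) \<le> \<phi> x"
proof -
  interpret linear \<phi> using assms by (rule smooth_at_linear)
  have "\<phi> x = norm v - \<phi> (v - x)" using smooth_at_self[OF assms] by (simp add: diff)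
  moreover have "norm x \<le> norm v + norm (v - x)"
    by (metis norm_minus_commute norm_triangle_sub)
  ultimately show ?thesis using smooth_at_le_norm[OF assms, of "v - x"] by linarith
qed

text \<open>
  The norm is the supremum of the smooth functionals, because smooth points are dense.
\<close>

lemma norm_le_if_smooth_functionals_le:
  fixes x :: "'a::real_normed_vector"
  assumes fd: "\<exists>B :: 'a set. finite B \<and> span B = UNIV"
    and "M \<ge> 0" "\<And>\<phi>. \<phi> \<in> smooth_functionals \<Longrightarrow> \<phi> x \<le> M"
  shows "norm x \<le> M"
proof (cases "x = 0")
  case False
  show ?thesis
  proof (rule field_le_epsilon)
    fix e :: real assume "e > 0"
    then obtain v \<phi> where "smooth_at v \<phi>" "norm (v - x) < e / 2"
      using smooth_points_dense[OF fd False, of "e / 2"] by auto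
    moreover from this have "\<phi> x \<le> M" using assms(3) by (auto simp: smooth_functionals_def)
    ultimately show "norm x \<le> M + e" using smooth_near_value[of v \<phi> x] by linarith
  qed
qed (use assms in simp)

text \<open>
  Far out in direction \<open>v\<close>, differences of distances are differences of values of \<open>\<phi>\<close>
  (\<open>\<phi>\<close> is the Busemann function of the ray). The direction \<open>w\<close> need not be exactly \<open>v\<close>: by convexity
  the difference quotient over the short step \<open>1 / t\<close> is at most the one over a fixed step \<open>\<delta>\<close>, and
  the latter depends continuously on the base point.
\<close>

lemma norm_difference_along_ray:
  assumes "smooth_at v \<phi>" "e > 0"
  shows "\<exists>\<eta>>0. \<exists>t0>0. \<forall>w t. norm (w - v) < \<eta> \<longrightarrow> t \<ge> t0 \<longrightarrow>
     norm (t *\<^sub>R w + x) - norm (t *\<^sub>R w + y) \<le> \<phi> (x - y) + e"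
proof -
  obtain C where C: "C > 0" "\<And>h. norm (v + h) \<le> norm v + \<phi> h + C * (norm h)\<^sup>2"
    using smooth_atE[OF assms(1)] by blast
  interpret linear \<phi> using assms(1) by (rule smooth_at_linear)
  define z where "z = x - y"
  define \<delta> where "\<delta> = e / (2 * C * ((norm z)\<^sup>2 + 1))"
  have \<delta>: "\<delta> > 0" unfolding \<delta>_def using assms(2) C(1) by (simp add: add_nonneg_pos)
  have "C * \<delta> * (norm z)\<^sup>2 \<le> C * \<delta> * ((norm z)\<^sup>2 + 1)"
    using \<delta> C(1) by (intro mult_left_mono) auto
  also have "\<dots> = e / 2"
    unfolding \<delta>_def using C(1) by (simp add: field_simps add_nonneg_eq_0_iff)
  finally have \<delta>2: "C * \<delta> * (norm z)\<^sup>2 \<le> e / 2" .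
  define \<eta> where "\<eta> = \<delta> * e / 8"
  define t0 where "t0 = 1 / \<delta> + norm y / \<eta>"
  have \<eta>: "\<eta> > 0" using \<delta> assms(2) by (simp add: \<eta>_def)
  have t0: "t0 > 0" using \<delta> \<eta> by (simp add: t0_def add_pos_nonneg)
  have "norm (t *\<^sub>R w + x) - norm (t *\<^sub>R w + y) \<le> \<phi> (x - y) + e"
    if w: "norm (w - v) < \<eta>" and t: "t \<ge> t0" for w t
  proof -
    have tpos: "t > 0" using t t0 by linarith
    have "1 / \<delta> \<le> t" "norm y / \<eta> \<le> t"
      using t \<delta> \<eta> unfolding t0_def by (smt (verit) divide_nonneg_pos norm_ge_zero)+
    then have t1: "1 \<le> t * \<delta>" and t2: "norm y / t \<le> \<eta>"
      using \<delta> \<eta> tpos by (simp_all add: field_simps)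
    define b where "b = w + (1 / t) *\<^sub>R y"
    have bv: "norm (b - v) \<le> 2 * \<eta>"
    proof -
      have "norm (b - v) \<le> norm (w - v) + norm ((1 / t) *\<^sub>R y)"
        unfolding b_def using norm_triangle_ineq[of "w - v" "(1 / t) *\<^sub>R y"] by (simp add: algebra_simps)
      then show ?thesis using w t2 tpos by simp
    qed
    have ty: "t *\<^sub>R w + y = t *\<^sub>R b" using tpos by (simp add: b_def scaleR_add_right)
    have tx: "\<delta> *\<^sub>R (t *\<^sub>R w + x) = (t * \<delta> - 1) *\<^sub>R b + (b + \<delta> *\<^sub>R z)"
      using tpos by (simp add: b_def z_def algebra_simps)
    have "\<delta> * norm (t *\<^sub>R w + x) = norm (\<delta> *\<^sub>R (t *\<^sub>R w + x))" using \<delta> by simp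
    also have "\<dots> \<le> (t * \<delta> - 1) * norm b + norm (b + \<delta> *\<^sub>R z)"
      unfolding tx using norm_triangle_ineq[of "(t * \<delta> - 1) *\<^sub>R b" "b + \<delta> *\<^sub>R z"] t1 by simp
    also have "norm (b + \<delta> *\<^sub>R z) \<le> norm (v + \<delta> *\<^sub>R z) + norm (b - v)"
      using norm_triangle_ineq[of "v + \<delta> *\<^sub>R z" "b - v"] by (simp add: algebra_simps)
    also have "norm (v + \<delta> *\<^sub>R z) \<le> norm v + \<delta> * \<phi> z + C * (\<delta> * norm z)\<^sup>2"
      using C(2)[of "\<delta> *\<^sub>R z"] \<delta> by (simp add: scale)
    also have "norm v \<le> norm b + norm (b - v)"
      by (metis norm_minus_commute norm_triangle_sub)
    finally have "\<delta> * norm (t *\<^sub>R w + x) \<le> t * \<delta> * norm b + \<delta> * \<phi> z + \<delta> * (C * \<delta> * (norm z)\<^sup>2) + 2 * norm (b - v)"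
      by (simp add: algebra_simps power2_eq_square)
    also have "\<dots> \<le> t * \<delta> * norm b + \<delta> * \<phi> z + \<delta> * (e / 2) + 2 * (2 * \<eta>)"
      using mult_left_mono[OF \<delta>2 less_imp_le[OF \<delta>]] bv by linarith
    also have "\<dots> = \<delta> * (norm (t *\<^sub>R w + y) + \<phi> z + e)"
      unfolding ty \<eta>_def using tpos by (simp add: algebra_simps)
    finally show ?thesis using \<delta> by (simp add: z_def)
  qed
  then show ?thesis using \<eta> t0 by blast
qed

section \<open>Step maps and their asymptotic linear isometries\<close>

lemma dense_approx:
  assumes "closure S = (UNIV :: 'a::real_normed_vector set)" "e > 0"
  obtains s where "s \<in> S" "norm (s - x) < e"
  using assms by (metis UNIV_I closure_approachable dist_norm)

definition step_map :: "real \<Rightarrow> 'a::real_normed_vector set \<Rightarrow> ('a \<Rightarrow> 'a) \<Rightarrow> bool" where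
  "step_map r S k \<longleftrightarrow> bij_betw k S S \<and>
     (\<forall>x\<in>S. \<forall>y\<in>S. norm (x - y) < r \<longleftrightarrow> norm (k x - k y) < r)"

lemma step_map_inv_into:
  assumes "step_map r S k" shows "step_map r S (inv_into S k)"
proof -
  have b: "bij_betw k S S" using assms by (simp add: step_map_def)
  have "bij_betw (inv_into S k) S S" by (rule bij_betw_inv_into[OF b])
  moreover have "norm (x - y) < r \<longleftrightarrow> norm (inv_into S k x - inv_into S k y) < r"
    if "x \<in> S" "y \<in> S" for x y
  proof -
    have "inv_into S k x \<in> S" "inv_into S k y \<in> S"
      using that b by (simp_all add: bij_betw_def inv_into_into)
    then show ?thesis
      using assms that bij_betw_inv_into_right[OF b] unfolding step_map_def by metis
  qed
  ultimately show ?thesis by (simp add: step_map_def)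
qed

lemma step_map_comp:
  assumes "step_map r S k" "step_map r S l" shows "step_map r S (l \<circ> k)"
proof -
  have "bij_betw (l \<circ> k) S S" using assms by (auto simp: step_map_def intro: bij_betw_trans)
  moreover have "norm (x - y) < r \<longleftrightarrow> norm ((l \<circ> k) x - (l \<circ> k) y) < r"
    if "x \<in> S" "y \<in> S" for x y
    using assms that unfolding step_map_def comp_apply by (metis bij_betw_apply)
  ultimately show ?thesis by (simp add: step_map_def)
qed

text \<open>
  Points at distance less than \<open>n * r\<close> are joined by a chain of \<open>n\<close> steps of length less than \<open>r\<close>
  through points of the dense set.
\<close>

lemma multiple_steps:
  fixes S :: "'a::real_normed_vector set"
  assumes dense: "closure S = UNIV" and "r > 0"
    and step: "\<And>x y. x \<in> S \<Longrightarrow> y \<in> S \<Longrightarrow> norm (x - y) < r \<Longrightarrow> norm (k x - k y) < r"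
  shows "x \<in> S \<Longrightarrow> y \<in> S \<Longrightarrow> norm (x - y) < real (Suc j) * r \<Longrightarrow> norm (k x - k y) < real (Suc j) * r"
proof (induction j arbitrary: x)
  case 0 then show ?case using step by simp
next
  case (Suc j)
  define N where "N = real (Suc (Suc j))"
  have N: "N > 0" "N = real (Suc j) + 1" by (simp_all add: N_def)
  define p where "p = x + (1 / N) *\<^sub>R (y - x)"
  have "norm (x - p) = norm (x - y) / N"
    unfolding p_def using N by (simp add: norm_minus_commute)
  also have "\<dots> < r" using Suc.prems(3) N by (simp add: divide_less_eq mult.commute N_def[symmetric])
  finally have xp: "norm (x - p) < r" .
  have "p - y = (real (Suc j) / N) *\<^sub>R (x - y)"
    unfolding p_def using N by (simp add: algebra_simps divide_simps) (simp add: scaleR_add_left[symmetric] add_divide_distrib[symmetric])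
  then have "norm (p - y) = real (Suc j) / N * norm (x - y)" using N by simp
  also have "\<dots> < real (Suc j) / N * (N * r)"
    using Suc.prems(3) N by (intro mult_strict_left_mono) (auto simp: N_def)
  finally have py: "norm (p - y) < real (Suc j) * r" using N by simp
  define e where "e = min (r - norm (x - p)) (real (Suc j) * r - norm (p - y))"
  obtain z where z: "z \<in> S" "norm (z - p) < e"
    using dense_approx[OF dense, of e p] xp py by (auto simp: e_def)
  have "norm (x - z) < r"
    using norm_triangle_ineq[of "x - p" "p - z"] z(2) by (simp add: e_def norm_minus_commute)
  moreover have "norm (z - y) < real (Suc j) * r"
    using norm_triangle_ineq[of "z - p" "p - y"] z(2) by (simp add: e_def)
  ultimately have "norm (k x - k z) < r" "norm (k z - k y) < real (Suc j) * r"
    using step[OF Suc.prems(1) z(1)] Suc.IH[OF z(1) Suc.prems(2)] by auto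
  moreover have "norm (k x - k y) \<le> norm (k x - k z) + norm (k z - k y)"
    using norm_triangle_ineq[of "k x - k z" "k z - k y"] by simp
  ultimately show ?case by (simp add: algebra_simps)
qed

context
  fixes S :: "'a::real_normed_vector set" and r :: real and k :: "'a \<Rightarrow> 'a"
  assumes dense: "closure S = UNIV" and r: "r > 0" and step: "step_map r S k"
begin

lemma step_map_in: "x \<in> S \<Longrightarrow> k x \<in> S"
  using step by (auto simp: step_map_def bij_betw_def)

lemma step_map_multiple:
  assumes "x \<in> S" "y \<in> S" "n > 0"
  shows "norm (x - y) < real n * r \<longleftrightarrow> norm (k x - k y) < real n * r"
proof -
  obtain j where j: "n = Suc j" using assms(3) gr0_implies_Suc by blast
  have b: "bij_betw k S S" using step by (simp add: step_map_def)
  have "norm (k x - k y) < real n * r" if "norm (x - y) < real n * r"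
    using multiple_steps[OF dense r, of k x y j] step assms that
    unfolding j step_map_def by blast
  moreover have "norm (x - y) < real n * r" if "norm (k x - k y) < real n * r"
    using multiple_steps[OF dense r, of "inv_into S k" "k x" "k y" j] step_map_inv_into[OF step]
      assms that step_map_in bij_betw_inv_into_left[OF b]
    unfolding j step_map_def by auto
  ultimately show ?thesis by blast
qed

lemma step_map_coarse_isometry:
  assumes "x \<in> S" "y \<in> S"
  shows "\<bar>norm (k x - k y) - norm (x - y)\<bar> \<le> r"
proof -
  have "b < a + r" if *: "\<And>n. n > 0 \<Longrightarrow> a < real n * r \<Longrightarrow> b < real n * r" and "a \<ge> 0" for a b
  proof -
    define n where "n = Suc (nat \<lfloor>a / r\<rfloor>)"
    have fl: "real (nat \<lfloor>a / r\<rfloor>) = of_int \<lfloor>a / r\<rfloor>" using that r by simp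
    have "a / r < real n" unfolding n_def of_nat_Suc fl by linarith
    then have "a < real n * r" using r by (simp add: field_simps)
    then have "b < real n * r" using *[of n] by (simp add: n_def)
    moreover have "real n \<le> a / r + 1" unfolding n_def of_nat_Suc fl by linarith
    then have "real n * r \<le> (a / r + 1) * r" using r by (intro mult_right_mono) auto
    then have "real n * r \<le> a + r" using r by (simp add: distrib_right)
    ultimately show ?thesis by linarith
  qed
  from this[of "norm (x - y)" "norm (k x - k y)"] this[of "norm (k x - k y)" "norm (x - y)"]
  show ?thesis using step_map_multiple[OF assms] by fastforce
qed

end

text \<open>
  \<open>T\<close> is a limit of the rescaled maps \<open>k (n x) / n\<close> along some subnet. As \<open>k\<close> is defined on \<open>S\<close> only,
  \<open>n x\<close> is replaced by a point \<open>s\<close> of \<open>S\<close> within distance 1. Approximation on finite sets at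
  arbitrarily large scales is all that a cluster point in the product topology gives, and it suffices
  below.
\<close>

definition asymptotic_to :: "'a::real_normed_vector set \<Rightarrow> ('a \<Rightarrow> 'a) \<Rightarrow> ('a \<Rightarrow> 'a) \<Rightarrow> bool" where
  "asymptotic_to S k T \<longleftrightarrow> (\<forall>X \<epsilon> N. finite X \<longrightarrow> \<epsilon> > 0 \<longrightarrow>
     (\<exists>n\<ge>N. n > 0 \<and> (\<forall>x\<in>X. \<exists>s\<in>S. norm (s - real n *\<^sub>R x) \<le> 1 \<and>
        norm (k s - real n *\<^sub>R T x) \<le> \<epsilon> * real n)))"

lemma asymptotic_toD:
  assumes "asymptotic_to S k T" "finite X" "\<epsilon> > 0"
  obtains n where "n \<ge> N" "n > 0"
    "\<And>x. x \<in> X \<Longrightarrow> \<exists>s\<in>S. norm (s - real n *\<^sub>R x) \<le> 1 \<and> norm (k s - real n *\<^sub>R T x) \<le> \<epsilon> * real n"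
  using assms unfolding asymptotic_to_def by meson

text \<open>
  The rescaled maps take values in a product of closed balls, which is compact by Tychonoff's theorem.
\<close>

lemma asymptotic_map_exists:
  fixes S :: "'a::real_normed_vector set"
  assumes fd: "\<exists>B :: 'a set. finite B \<and> span B = UNIV"
    and dense: "closure S = UNIV" and r: "r > 0" and step: "step_map r S k"
  obtains T where "asymptotic_to S k T"
proof -
  obtain s0 where s0: "s0 \<in> S" using dense_approx[OF dense, of 1] by auto
  have "\<exists>s\<in>S. norm (s - y) \<le> 1" for y
    using dense_approx[OF dense, of 1 y] by (metis less_imp_le zero_less_one)
  then obtain \<tau> where \<tau>: "\<And>y. \<tau> y \<in> S" "\<And>y. norm (\<tau> y - y) \<le> 1" by metis
  \<comment> \<open>For \<open>n = 0\<close> this is 0, which is harmless as only large \<open>n\<close> are used.\<close>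
  define g where "g n x = (1 / real n) *\<^sub>R k (\<tau> (real n *\<^sub>R x))" for n x
  define C where "C = norm (k s0) + norm s0 + 1 + r"
  have C: "C > 0" using r by (simp add: C_def add_nonneg_pos add_pos_pos)
  have gC: "norm (g n x) \<le> norm x + C" for n x
  proof (cases "n = 0")
    case False
    then have n: "real n \<ge> 1" by simp
    define s where "s = \<tau> (real n *\<^sub>R x)"
    have "norm (k s) \<le> norm (k s0) + norm (k s - k s0)" by (rule norm_triangle_sub)
    moreover have "norm (k s - k s0) \<le> norm (s - s0) + r"
      using step_map_coarse_isometry[OF dense r step, of s s0] \<tau>(1) s0 by (simp add: s_def)
    moreover have "norm (s - s0) \<le> norm s + norm s0" by (rule norm_triangle_ineq4)
    moreover have "norm s \<le> norm (real n *\<^sub>R x) + 1"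
      using \<tau>(2)[of "real n *\<^sub>R x"] norm_triangle_sub[of s "real n *\<^sub>R x"] by (simp add: s_def)
    ultimately have "norm (k s) \<le> real n * norm x + C" by (simp add: C_def)
    also have "\<dots> \<le> real n * (norm x + C)"
      using n C mult_right_mono[of 1 "real n" C] by (simp add: distrib_left)
    finally show ?thesis using n by (simp add: g_def s_def field_simps)
  qed (use C in \<open>simp add: g_def\<close>)
  define K where "K = PiE UNIV (\<lambda>x::'a. cball (0::'a) (norm x + C))"
  have "compactin (product_topology (\<lambda>_. euclidean) UNIV) K"
    unfolding K_def compactin_PiE using compact_cball_finite_dim[OF fd] by simp
  then have cK: "compact K" by (simp add: euclidean_product_topology)
  have "g n \<in> K" for n unfolding K_def using gC by auto
  then have "eventually (\<lambda>f. f \<in> K) (filtermap g sequentially)"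
    by (simp add: eventually_filtermap)
  moreover have "filtermap g sequentially \<noteq> bot" by (simp add: filtermap_bot_iff)
  ultimately obtain T where T: "inf (nhds T) (filtermap g sequentially) \<noteq> bot"
    using cK unfolding compact_filter by blast
  have "asymptotic_to S k T"
    unfolding asymptotic_to_def
  proof (intro allI impI)
    fix X :: "'a set" and \<epsilon> :: real and N :: nat
    assume X: "finite X" "\<epsilon> > 0"
    define U where "U = {f :: 'a \<Rightarrow> 'a. \<forall>x\<in>X. f x \<in> ball (T x) \<epsilon>}"
    have "open U"
      unfolding U_def using product_topology_basis'[OF X(1), of "\<lambda>x. ball (T x) \<epsilon>" "\<lambda>x. x"] by simp
    moreover have "T \<in> U" using X by (simp add: U_def)
    ultimately have "eventually (\<lambda>f. f \<in> U) (nhds T)" by (auto simp: eventually_nhds)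
    moreover have "eventually (\<lambda>f. \<exists>n\<ge>max N 1. f = g n) (filtermap g sequentially)"
      unfolding eventually_filtermap using eventually_ge_at_top[of "max N 1"]
      by eventually_elim blast
    ultimately have "eventually (\<lambda>f. f \<in> U \<and> (\<exists>n\<ge>max N 1. f = g n)) (inf (nhds T) (filtermap g sequentially))"
      unfolding eventually_inf by blast
    then obtain n where n: "n \<ge> max N 1" "g n \<in> U"
      using eventually_happens'[OF T] by blast
    have "\<exists>s\<in>S. norm (s - real n *\<^sub>R x) \<le> 1 \<and> norm (k s - real n *\<^sub>R T x) \<le> \<epsilon> * real n" if "x \<in> X" for x
    proof -
      have "norm (g n x - T x) \<le> \<epsilon>"
        using n(2) that by (fastforce simp: U_def dist_norm norm_minus_commute)
      then have "real n * norm (g n x - T x) \<le> real n * \<epsilon>" by (intro mult_left_mono) auto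
      moreover have "k (\<tau> (real n *\<^sub>R x)) - real n *\<^sub>R T x = real n *\<^sub>R (g n x - T x)"
        using n(1) by (simp add: g_def scaleR_diff_right)
      ultimately show ?thesis using \<tau> by (intro bexI[of _ "\<tau> (real n *\<^sub>R x)"]) (auto simp: mult.commute)
    qed
    then show "\<exists>n\<ge>N. n > 0 \<and> (\<forall>x\<in>X. \<exists>s\<in>S. norm (s - real n *\<^sub>R x) \<le> 1 \<and>
        norm (k s - real n *\<^sub>R T x) \<le> \<epsilon> * real n)"
      using n(1) by (intro exI[of _ n]) auto
  qed
  then show ?thesis using that by blast
qed

lemma asymptotic_map_isometry:
  fixes S :: "'a::real_normed_vector set"
  assumes dense: "closure S = UNIV" and r: "r > 0" and step: "step_map r S k"
    and T: "asymptotic_to S k T"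
  shows "norm (T x - T y) = norm (x - y)"
proof -
  have "\<bar>norm (T x - T y) - norm (x - y)\<bar> \<le> 0 + e" if "e > 0" for e
  proof -
    obtain N :: nat where N: "(2 + r) / (e / 3) < real N" using reals_Archimedean2 by blast
    obtain n where n: "n \<ge> N" "n > 0" and a:
      "\<And>z. z \<in> {x, y} \<Longrightarrow> \<exists>s\<in>S. norm (s - real n *\<^sub>R z) \<le> 1 \<and> norm (k s - real n *\<^sub>R T z) \<le> e / 3 * real n"
      using asymptotic_toD[OF T, of "{x, y}" "e / 3" N] \<open>e > 0\<close> by auto
    obtain s where s: "s \<in> S" "norm (s - real n *\<^sub>R x) \<le> 1" "norm (k s - real n *\<^sub>R T x) \<le> e / 3 * real n"
      using a[of x] by auto
    obtain t where t: "t \<in> S" "norm (t - real n *\<^sub>R y) \<le> 1" "norm (k t - real n *\<^sub>R T y) \<le> e / 3 * real n"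
      using a[of y] by auto
    have tri: "\<bar>norm (a - b) - norm (c - d)\<bar> \<le> norm (a - c) + norm (b - d)" for a b c d :: 'a
    proof -
      have "\<bar>norm (a - b) - norm (c - d)\<bar> \<le> norm ((a - b) - (c - d))" by (rule norm_triangle_ineq3)
      also have "(a - b) - (c - d) = (a - c) - (b - d)" by simp
      also have "norm \<dots> \<le> norm (a - c) + norm (b - d)" by (rule norm_triangle_ineq4)
      finally show ?thesis .
    qed
    have "\<bar>norm (s - t) - norm (real n *\<^sub>R x - real n *\<^sub>R y)\<bar> \<le> 2"
      using tri[of s t "real n *\<^sub>R x" "real n *\<^sub>R y"] s(2) t(2) by simp
    moreover have "\<bar>norm (k s - k t) - norm (real n *\<^sub>R T x - real n *\<^sub>R T y)\<bar> \<le> 2 * (e / 3 * real n)"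
      using tri[of "k s" "k t" "real n *\<^sub>R T x" "real n *\<^sub>R T y"] s(3) t(3) by simp
    moreover have "\<bar>norm (k s - k t) - norm (s - t)\<bar> \<le> r"
      by (rule step_map_coarse_isometry[OF dense r step s(1) t(1)])
    moreover have "2 + r \<le> e / 3 * real n"
    proof -
      have "(2 + r) / (e / 3) \<le> real n" using N n(1) by linarith
      then show ?thesis using \<open>e > 0\<close> by (simp add: field_simps)
    qed
    moreover have "norm (real n *\<^sub>R x - real n *\<^sub>R y) = real n * norm (x - y)"
      "norm (real n *\<^sub>R T x - real n *\<^sub>R T y) = real n * norm (T x - T y)"
      by (simp_all flip: scaleR_diff_right)
    moreover have "real n * e = 3 * (e / 3 * real n)" by simp
    ultimately have "\<bar>real n * norm (T x - T y) - real n * norm (x - y)\<bar> \<le> real n * e"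
      by linarith
    then have "real n * \<bar>norm (T x - T y) - norm (x - y)\<bar> \<le> real n * e"
      by (simp flip: right_diff_distrib add: abs_mult)
    then show ?thesis using n(2) by simp
  qed
  then have "\<bar>norm (T x - T y) - norm (x - y)\<bar> \<le> 0" by (rule field_le_epsilon)
  then show ?thesis by simp
qed

lemma asymptotic_map_zero:
  fixes S :: "'a::real_normed_vector set"
  assumes dense: "closure S = UNIV" and r: "r > 0" and step: "step_map r S k"
    and T: "asymptotic_to S k T"
  shows "T 0 = 0"
proof -
  obtain s0 where s0: "s0 \<in> S" using dense_approx[OF dense, of 1] by auto
  define C where "C = norm (k s0) + norm s0 + 1 + r"
  have "norm (T 0) \<le> 0 + e" if "e > 0" for e
  proof -
    obtain N :: nat where N: "C / (e / 2) < real N" using reals_Archimedean2 by blast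
    obtain n where n: "n \<ge> N" "n > 0" and
      a: "\<And>x. x \<in> {0} \<Longrightarrow> \<exists>s\<in>S. norm (s - real n *\<^sub>R x) \<le> 1 \<and> norm (k s - real n *\<^sub>R T x) \<le> e / 2 * real n"
      using asymptotic_toD[OF T, of "{0}" "e / 2" N] \<open>e > 0\<close> by auto
    obtain s where s: "s \<in> S" "norm s \<le> 1" "norm (k s - real n *\<^sub>R T 0) \<le> e / 2 * real n"
      using a[of 0] by auto
    have "norm (k s) \<le> norm (k s0) + norm (k s - k s0)" by (rule norm_triangle_sub)
    moreover have "norm (k s - k s0) \<le> norm (s - s0) + r"
      using step_map_coarse_isometry[OF dense r step s(1) s0] by simp
    moreover have "norm (s - s0) \<le> norm s + norm s0" by (rule norm_triangle_ineq4)
    moreover have "norm (real n *\<^sub>R T 0) \<le> norm (k s) + norm (k s - real n *\<^sub>R T 0)"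
      by (metis norm_minus_commute norm_triangle_sub)
    ultimately have "norm (real n *\<^sub>R T 0) \<le> C + e / 2 * real n"
      using s by (simp add: C_def)
    moreover have "C \<le> e / 2 * real n"
    proof -
      have "C / (e / 2) \<le> real n" using N n(1) by linarith
      then show ?thesis using \<open>e > 0\<close> by (simp add: field_simps)
    qed
    ultimately have "real n * norm (T 0) \<le> real n * e" by (simp add: mult.commute)
    then show ?thesis using n(2) by simp
  qed
  then have "norm (T 0) \<le> 0" by (rule field_le_epsilon)
  then show ?thesis by simp
qed

text \<open>
  If \<open>y\<close> is at distance \<open>\<delta> > 0\<close> from the image of a ball, the points of its orbit under \<open>T\<close> have mutual
  distances at least \<open>\<delta>\<close>, contradicting compactness.
\<close>

lemma isometry_surj_finite_dim:
  fixes T :: "'a::real_normed_vector \<Rightarrow> 'a"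
  assumes fd: "\<exists>B :: 'a set. finite B \<and> span B = UNIV"
    and iso: "\<And>x y. norm (T x - T y) = norm (x - y)" and T0: "T 0 = 0"
  shows "surj T"
proof (rule ccontr)
  assume "\<not> surj T"
  then obtain y where y: "y \<notin> range T" by auto
  define K where "K = cball (0::'a) (norm y)"
  have cK: "compact K" unfolding K_def by (rule compact_cball_finite_dim[OF fd])
  have nT: "norm (T x) = norm x" for x using iso[of x 0] T0 by simp
  have "continuous_on K T"
    by (rule continuous_onI) (auto simp: dist_norm iso intro!: exI)
  then have "closed (T ` K)" using cK compact_continuous_image compact_imp_closed by blast
  then obtain \<delta> where \<delta>: "\<delta> > 0" "\<And>z. z \<in> K \<Longrightarrow> \<delta> \<le> dist y (T z)"
  proof -
    have "open (- (T ` K))" "y \<in> - (T ` K)" using \<open>closed (T ` K)\<close> y by auto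
    then obtain \<delta> where "\<delta> > 0" "ball y \<delta> \<subseteq> - (T ` K)" using open_contains_ball by blast
    then have "\<delta> \<le> dist y (T z)" if "z \<in> K" for z
      using that by (force simp: not_less[symmetric])
    then show ?thesis using that \<open>\<delta> > 0\<close> by blast
  qed
  define u where "u n = (T ^^ n) y" for n
  have "norm (u n) = norm y" for n
    unfolding u_def by (induction n) (simp_all add: nT)
  then have uK: "u n \<in> K" for n by (simp add: K_def)
  have shift: "dist (u m) (u (m + d)) = dist y (u d)" for m d
    by (induction m) (simp_all add: u_def dist_norm iso)
  have far: "\<delta> \<le> dist (u m) (u n)" if "m < n" for m n
  proof -
    obtain d where "n = m + Suc d" using less_imp_Suc_add \<open>m < n\<close> by auto
    then show ?thesis using shift[of m "Suc d"] \<delta>(2)[OF uK[of d]] by (simp add: u_def)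
  qed
  obtain l q where q: "strict_mono q" "(u \<circ> q) \<longlonglongrightarrow> l"
    using cK uK unfolding compact_eq_seq_compact_metric seq_compact_def by blast
  then have "Cauchy (u \<circ> q)" by (simp add: LIMSEQ_imp_Cauchy)
  then obtain M where "\<And>m n. m \<ge> M \<Longrightarrow> n \<ge> M \<Longrightarrow> dist ((u \<circ> q) m) ((u \<circ> q) n) < \<delta>"
    using \<delta>(1) unfolding Cauchy_def by meson
  from this[of M "Suc M"] far[of "q M" "q (Suc M)"] show False
    using q(1) by (simp add: strict_mono_Suc_iff)
qed

text \<open>
  Nica's variant of Vaisala's proof of the Mazur-Ulam theorem. Composing \<open>T\<close> with the reflection in
  the midpoint of \<open>T x\<close> and \<open>T y\<close> and with \<open>T\<inverse>\<close> gives an isometry that swaps \<open>x\<close> and \<open>y\<close> and whose midpoint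
  defect is twice that of \<open>T\<close>. All these defects obey the same bound.
\<close>

lemma isometry_midpoint_defect:
  fixes T :: "'a::real_normed_vector \<Rightarrow> 'a"
  assumes "bij T" "\<And>u v. norm (T u - T v) = norm (u - v)"
  shows "2 ^ n * norm (T ((1/2) *\<^sub>R (x + y)) - (1/2) *\<^sub>R (T x + T y)) \<le> norm (x - y) / 2"
  using assms
proof (induction n arbitrary: T x y)
  case 0
  define m where "m = (1/2) *\<^sub>R (x + y)"
  have half: "norm ((1/2) *\<^sub>R z) = norm z / 2" for z :: 'a by simp
  have "m - x = (1/2) *\<^sub>R (y - x)" "m - y = (1/2) *\<^sub>R (x - y)"
    by (simp_all add: m_def algebra_simps flip: scaleR_add_left)
  then have mm: "norm (m - x) = norm (x - y) / 2" "norm (m - y) = norm (x - y) / 2"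
    using half by (simp_all add: norm_minus_commute)
  have "T m - (1/2) *\<^sub>R (T x + T y) = (1/2) *\<^sub>R ((T m - T x) + (T m - T y))"
    by (simp add: algebra_simps flip: scaleR_add_left)
  then have "norm (T m - (1/2) *\<^sub>R (T x + T y)) \<le> (norm (T m - T x) + norm (T m - T y)) / 2"
    using half norm_triangle_ineq[of "T m - T x" "T m - T y"] by simp
  then show ?case using mm by (simp add: 0(2) flip: m_def)
next
  case (Suc n)
  define m where "m = (1/2) *\<^sub>R (x + y)"
  define F where "F z = inv T (T x + T y - T z)" for z
  have TF: "T (F z) = T x + T y - T z" for z
    unfolding F_def using Suc.prems(1) by (simp add: bij_is_surj surj_f_inv_f)
  have inj: "T u = T v \<Longrightarrow> u = v" for u v using Suc.prems(1) by (simp add: bij_is_inj inj_eq)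
  have "F (F z) = z" for z by (rule inj) (simp add: TF)
  then have "bij F" by (rule involuntory_imp_bij)
  moreover have "norm (F u - F v) = norm (u - v)" for u v
  proof -
    have "norm (F u - F v) = norm (T (F u) - T (F v))" by (simp add: Suc.prems(2))
    also have "\<dots> = norm (T v - T u)" by (simp add: TF)
    finally show ?thesis by (simp add: Suc.prems(2) norm_minus_commute)
  qed
  ultimately have "2 ^ n * norm (F m - (1/2) *\<^sub>R (F x + F y)) \<le> norm (x - y) / 2"
    unfolding m_def by (rule Suc.IH)
  moreover have "F x = y" "F y = x" by (rule inj, simp add: TF)+
  moreover have "norm (F m - m) = 2 * norm (T m - (1/2) *\<^sub>R (T x + T y))"
  proof -
    have "norm (F m - m) = norm (T (F m) - T m)" by (simp add: Suc.prems(2))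
    also have "T (F m) - T m = (-2) *\<^sub>R (T m - (1/2) *\<^sub>R (T x + T y))"
      by (simp add: TF algebra_simps scaleR_2)
    finally show ?thesis by simp
  qed
  ultimately show ?case by (simp add: m_def add.commute)
qed

lemma isometry_midpoint:
  fixes T :: "'a::real_normed_vector \<Rightarrow> 'a"
  assumes "bij T" "\<And>u v. norm (T u - T v) = norm (u - v)"
  shows "T ((1/2) *\<^sub>R (x + y)) = (1/2) *\<^sub>R (T x + T y)"
proof (rule ccontr)
  define d where "d = norm (T ((1/2) *\<^sub>R (x + y)) - (1/2) *\<^sub>R (T x + T y))"
  assume "\<not> ?thesis"
  then have "d > 0" by (simp add: d_def)
  obtain n where "norm (x - y) / 2 / d < 2 ^ n" using real_arch_pow[of 2] by auto
  then have "norm (x - y) / 2 < 2 ^ n * d" using \<open>d > 0\<close> by (simp add: field_simps)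
  then show False using isometry_midpoint_defect[OF assms, of n x y] by (simp add: d_def)
qed

lemma additive_continuous_real:
  fixes f :: "real \<Rightarrow> 'a::real_normed_vector"
  assumes add: "\<And>s t. f (s + t) = f s + f t" and cont: "continuous_on UNIV f"
  shows "f t = t *\<^sub>R f 1"
proof -
  have f0: "f 0 = 0" using add[of 0 0] by simp
  have nat: "f (real n * s) = real n *\<^sub>R f s" for n s
    by (induction n) (simp_all add: f0 add algebra_simps)
  have neg: "f (- s) = - f s" for s using add[of s "- s"] f0 by (simp add: eq_neg_iff_add_eq_0 add.commute)
  have int: "f (of_int i * s) = of_int i *\<^sub>R f s" for i s
    by (cases i rule: int_cases2) (simp_all add: nat neg)
  have rat: "f q = q *\<^sub>R f 1" if q: "q \<in> \<rat>" for q
  proof -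
    obtain a b where ab: "b > 0" "q = of_int a / of_int b" using Rats_cases'[OF q] by blast
    have "of_int b *\<^sub>R f q = f (of_int a)" using int[of b q] ab by simp
    also have "\<dots> = of_int a *\<^sub>R f 1" using int[of a 1] by simp
    also have "\<dots> = of_int b *\<^sub>R (q *\<^sub>R f 1)" using ab by simp
    finally have "of_int b *\<^sub>R f q = of_int b *\<^sub>R (q *\<^sub>R f 1)" .
    then show ?thesis by (rule scaleR_left_imp_eq[rotated]) (use ab(1) in simp)
  qed
  have "closed {t. f t = t *\<^sub>R f 1}"
    by (intro closed_Collect_eq cont continuous_intros)
  moreover have "\<rat> \<subseteq> {t. f t = t *\<^sub>R f 1}" using rat by blast
  ultimately have "closure \<rat> \<subseteq> {t. f t = t *\<^sub>R f 1}" by (simp add: closure_minimal)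
  then show ?thesis by (auto simp: Rats_closure_real)
qed

lemma Mazur_Ulam:
  fixes T :: "'a::real_normed_vector \<Rightarrow> 'a"
  assumes "bij T" and iso: "\<And>u v. norm (T u - T v) = norm (u - v)" and T0: "T 0 = 0"
  shows "linear T"
proof -
  have dbl: "T (2 *\<^sub>R x) = 2 *\<^sub>R T x" for x
    using isometry_midpoint[OF assms(1,2), of "2 *\<^sub>R x" 0] T0 by simp
  have add: "T (x + y) = T x + T y" for x y
    using isometry_midpoint[OF assms(1,2), of "2 *\<^sub>R x" "2 *\<^sub>R y"] dbl
    by (simp flip: scaleR_add_right)
  have T: "continuous_on UNIV T"
    by (rule continuous_onI) (auto simp: dist_norm iso intro!: exI)
  have "T (c *\<^sub>R x) = c *\<^sub>R T x" for c x
    using additive_continuous_real[of "\<lambda>c. T (c *\<^sub>R x)" c]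
    by (simp add: scaleR_add_left add continuous_on_compose2[OF T] continuous_intros)
  then show ?thesis using add by (intro linearI) auto
qed

lemma asymptotic_linear_isometry:
  fixes S :: "'a::real_normed_vector set"
  assumes fd: "\<exists>B :: 'a set. finite B \<and> span B = UNIV"
    and dense: "closure S = UNIV" and r: "r > 0" and step: "step_map r S k"
  obtains T where "asymptotic_to S k T" "linear T" "bij T" "\<And>x. norm (T x) = norm x"
proof -
  obtain T where T: "asymptotic_to S k T" using asymptotic_map_exists[OF assms] .
  note iso = asymptotic_map_isometry[OF dense r step T]
  note T0 = asymptotic_map_zero[OF dense r step T]
  have "inj T" by (rule injI) (metis iso eq_iff_diff_eq_0 norm_eq_zero)
  then have b: "bij T" using isometry_surj_finite_dim[OF fd iso T0] by (simp add: bij_def)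
  have "norm (T x) = norm x" for x using iso[of x 0] T0 by simp
  then show ?thesis using that[OF T Mazur_Ulam[OF b iso T0] b] by blast
qed

section \<open>Step maps are monotone along smooth functionals\<close>

lemma smooth_functionals_dense_values:
  fixes S :: "'a::real_normed_vector set"
  assumes dense: "closure S = UNIV" and "smooth_at v \<phi>" "a < b"
  obtains x where "x \<in> S" "a < \<phi> x" "\<phi> x < b"
proof -
  interpret linear \<phi> using assms(2) by (rule smooth_at_linear)
  define p where "p = ((a + b) / 2 / norm v) *\<^sub>R v"
  have "v \<noteq> 0" using assms(2) by (simp add: smooth_at_def)
  then have "\<phi> p = (a + b) / 2" unfolding p_def scale smooth_at_self[OF assms(2)] by simp
  moreover obtain x where x: "x \<in> S" "norm (x - p) < (b - a) / 2"
    using dense_approx[OF dense, of "(b - a) / 2" p] assms(3) by auto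
  moreover have "\<bar>\<phi> x - \<phi> p\<bar> \<le> norm (x - p)"
    using smooth_at_abs_le_norm[OF assms(2), of "x - p"] by (simp add: diff)
  ultimately have "a < \<phi> x" "\<phi> x < b" unfolding abs_le_iff by (simp_all add: field_simps)
  then show ?thesis using that x(1) by blast
qed

text \<open>
  A monotone relation between two dense sets of reals is the graph of a continuous function: a jump
  would leave a gap in the second set.
\<close>

lemma monotone_extension:
  fixes p q :: "'a \<Rightarrow> real"
  assumes mono: "\<And>x y. x \<in> S \<Longrightarrow> y \<in> S \<Longrightarrow> p x \<le> p y \<Longrightarrow> q x \<le> q y"
    and p: "\<And>a b. a < b \<Longrightarrow> \<exists>x\<in>S. a < p x \<and> p x < b"
    and q: "\<And>a b. a < b \<Longrightarrow> \<exists>x\<in>S. a < q x \<and> q x < b"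
  obtains h where "mono h" "continuous_on UNIV h" "\<And>x. x \<in> S \<Longrightarrow> q x = h (p x)"
proof -
  define h where "h t = Sup {q x | x. x \<in> S \<and> p x \<le> t}" for t
  have ne: "{q x | x. x \<in> S \<and> p x \<le> t} \<noteq> {}" for t using p[of "t - 1" t] by force
  have bdd: "bdd_above {q x | x. x \<in> S \<and> p x \<le> t}" for t
  proof -
    obtain z where "z \<in> S" "t < p z" using p[of t "t + 1"] by auto
    then show ?thesis by (intro bdd_aboveI[of _ "q z"]) (use mono in fastforce)
  qed
  have "mono h"
    unfolding h_def by (intro monoI cSup_subset_mono ne bdd) auto
  moreover have hp: "q x = h (p x)" if "x \<in> S" for x
    unfolding h_def using that mono by (intro cSup_eq_maximum[symmetric]) auto
  moreover have "isCont h t" for t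
    unfolding continuous_at_eps_delta
  proof (intro allI impI)
    fix e :: real assume "e > 0"
    obtain x where x: "x \<in> S" "h t - e < q x" "q x < h t" using q[of "h t - e" "h t"] \<open>e > 0\<close> by auto
    obtain y where y: "y \<in> S" "h t < q y" "q y < h t + e" using q[of "h t" "h t + e"] \<open>e > 0\<close> by auto
    have "p x < t" using x hp[OF x(1)] \<open>mono h\<close> by (metis monoD not_le)
    moreover have "t < p y" using y hp[OF y(1)] \<open>mono h\<close> by (metis monoD not_le)
    moreover have "dist (h u) (h t) < e" if "p x < u" "u < p y" for u
    proof -
      have "q x \<le> h u" "h u \<le> q y" using that hp x y \<open>mono h\<close> by (metis less_imp_le monoD)+
      then show ?thesis using x y by (simp add: dist_real_def)
    qed
    ultimately show "\<exists>d>0. \<forall>u. dist u t < d \<longrightarrow> dist (h u) (h t) < e"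
      by (intro exI[of _ "min (t - p x) (p y - t)"]) (auto simp: dist_real_def abs_less_iff)
  qed
  ultimately show ?thesis using that continuous_at_imp_continuous_on by blast
qed

context
  fixes S :: "'a::real_normed_vector set" and r :: real and k T :: "'a \<Rightarrow> 'a"
  assumes dense: "closure S = UNIV" and r: "r > 0" and step: "step_map r S k"
    and asym: "asymptotic_to S k T" and linT: "linear T" and bijT: "bij T"
    and normT: "\<And>x. norm (T x) = norm x"
begin

lemma smooth_at_inv_asymptote:
  assumes "smooth_at v \<phi>" shows "smooth_at (T v) (\<lambda>x. \<phi> (inv T x))"
  using bijT by (intro smooth_at_isometry[OF assms linT normT])
    (simp_all add: bij_is_surj surj_f_inv_f bij_is_inj)

text \<open>
  Otherwise look at \<open>x\<close> and \<open>y\<close> from a far point \<open>s\<close> of \<open>S\<close> in direction \<open>-v\<close>, placed such that \<open>y\<close> is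
  slightly beyond distance \<open>n * r\<close> from \<open>s\<close>. Then \<open>x\<close> is within distance \<open>(n + m) * r\<close>, and both relations survive
  under \<open>k\<close>. As \<open>k s\<close> is far out in direction \<open>- T v\<close>, the difference of the two distances
  from \<open>k s\<close> is close to \<open>\<phi>' (k x) - \<phi>' (k y)\<close>, which is too large.
\<close>

lemma step_map_functional_mono:
  assumes \<phi>: "\<phi> \<in> smooth_functionals" and x: "x \<in> S" and y: "y \<in> S"
    and less: "\<phi> x < \<phi> y + of_int m * r"
  shows "\<phi> (inv T (k x)) \<le> \<phi> (inv T (k y)) + of_int m * r"
proof (rule ccontr)
  assume neg: "\<not> ?thesis"
  obtain v0 where "smooth_at v0 \<phi>" using \<phi> by (auto simp: smooth_functionals_def)
  define v where "v = (r / norm v0) *\<^sub>R v0"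
  have "v0 \<noteq> 0" using \<open>smooth_at v0 \<phi>\<close> by (simp add: smooth_at_def)
  then have sv: "smooth_at v \<phi>" and nv: "norm v = r"
    using smooth_at_scale[OF \<open>smooth_at v0 \<phi>\<close>] r by (simp_all add: v_def)
  define \<phi>' where "\<phi>' z = \<phi> (inv T z)" for z
  have sv': "smooth_at (T v) \<phi>'" unfolding \<phi>'_def by (rule smooth_at_inv_asymptote[OF sv])
  note lin = smooth_at_linear[OF sv] and lin' = smooth_at_linear[OF sv']
  obtain C where C: "C > 0" "\<And>h. norm (v + h) \<le> norm v + \<phi> h + C * (norm h)\<^sup>2"
    using smooth_atE[OF sv] by blast
  define g1 where "g1 = \<phi> y + of_int m * r - \<phi> x"
  define g2 where "g2 = \<phi>' (k x) - \<phi>' (k y) - of_int m * r"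
  have g1: "g1 > 0" using less by (simp add: g1_def)
  have g2: "g2 > 0" using neg by (simp add: g2_def \<phi>'_def)
  define \<epsilon> where "\<epsilon> = g1 / 8"
  \<comment> \<open>At height \<open>n + \<theta>\<close> along the ray, the distance to \<open>y\<close> is about \<open>n * r + g1 / 2\<close>.\<close>
  define \<theta> where "\<theta> = (g1 / 2 - \<phi> y) / r"
  have \<theta>r: "\<theta> * r = g1 / 2 - \<phi> y" using r by (simp add: \<theta>_def)
  have \<epsilon>: "\<epsilon> > 0" using g1 by (simp add: \<epsilon>_def)
  obtain \<eta> t0 where \<eta>: "\<eta> > 0" "t0 > 0" and ray:
    "\<And>w t. norm (w - T v) < \<eta> \<Longrightarrow> t \<ge> t0 \<Longrightarrow>
       norm (t *\<^sub>R w + k y) - norm (t *\<^sub>R w + k x) \<le> \<phi>' (k y - k x) + g2 / 2"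
    using norm_difference_along_ray[OF sv', of "g2 / 2" "k y" "k x"] g2 by auto
  \<comment> \<open>\<open>D\<close> bounds the distance of \<open>k s\<close> from the image of the point that approximates the ray in \<open>asymptotic_to\<close>.\<close>
  define D where "D = \<epsilon> + \<bar>\<theta>\<bar> * r + 1 + r"
  have D: "D > 0" using \<epsilon> r by (simp add: D_def add_pos_nonneg)
  define Q where "Q = C * (norm x)\<^sup>2 / \<epsilon>"
  have Q: "Q \<ge> 0" using C(1) \<epsilon> by (simp add: Q_def)
  obtain N :: nat where N: "t0 + 2 * D / \<eta> + \<bar>of_int m\<bar> + 1 + \<bar>\<theta>\<bar> + Q < real N"
    using reals_Archimedean2 by blast
  obtain n where n: "n \<ge> N" "n > 0" and a:
    "\<And>x. x \<in> {- v} \<Longrightarrow> \<exists>s\<in>S. norm (s - real n *\<^sub>R x) \<le> 1 \<and> norm (k s - real n *\<^sub>R T x) \<le> \<eta> / 2 * real n"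
    using asymptotic_toD[OF asym, of "{- v}" "\<eta> / 2" N] \<eta> by auto
  obtain s0 where s0: "s0 \<in> S" "norm (s0 + real n *\<^sub>R v) \<le> 1" "norm (k s0 + real n *\<^sub>R T v) \<le> \<eta> / 2 * real n"
    using a[of "- v"] by (auto simp: linear_neg[OF linT])
  have "2 * D / \<eta> > 0" using D \<eta> by simp
  then have n_ge: "t0 \<le> real n" "2 * D / \<eta> < real n" "real_of_int \<bar>m\<bar> < real n" "\<bar>\<theta>\<bar> + Q < real n"
    using N n(1) \<eta>(2) Q by (simp_all add: of_nat_le_iff[of N n, where ?'a = real, symmetric] del: of_nat_le_iff)
  define \<tau> where "\<tau> = real n + \<theta>"
  have \<tau>: "\<tau> > 0" "Q \<le> \<tau>" using n_ge(4) Q by (auto simp: \<tau>_def)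
  have \<tau>r: "\<tau> * r = real n * r + g1 / 2 - \<phi> y" by (simp add: \<tau>_def distrib_right \<theta>r)
  define p where "p = - (\<tau> *\<^sub>R v)"
  obtain s where s: "s \<in> S" "norm (s - p) < \<epsilon>" using dense_approx[OF dense \<epsilon>] by blast
  have "norm (y - p) \<ge> real n * r + g1 / 2"
    using smooth_at_support[OF smooth_at_scale[OF sv \<tau>(1)], of y] \<tau>(1) \<tau>r nv
    by (simp add: p_def add.commute)
  moreover have "norm (y - p) \<le> norm (y - s) + norm (s - p)"
    using norm_triangle_ineq[of "y - s" "s - p"] by simp
  ultimately have ys: "\<not> norm (y - s) < real n * r" using s(2) g1 by (simp add: \<epsilon>_def)
  have "norm (x - p) \<le> \<tau> * r + \<phi> x + \<epsilon>"
  proof -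
    have "x - p = \<tau> *\<^sub>R (v + (1 / \<tau>) *\<^sub>R x)" using \<tau>(1) by (simp add: p_def scaleR_add_right)
    then have "norm (x - p) = \<tau> * norm (v + (1 / \<tau>) *\<^sub>R x)" using \<tau>(1) by simp
    also have "\<dots> \<le> \<tau> * (norm v + \<phi> ((1 / \<tau>) *\<^sub>R x) + C * (norm ((1 / \<tau>) *\<^sub>R x))\<^sup>2)"
      using \<tau>(1) by (intro mult_left_mono[OF C(2)]) auto
    also have "\<dots> = \<tau> * r + \<phi> x + C * (norm x)\<^sup>2 / \<tau>"
      using \<tau>(1) by (simp add: nv linear_scale[OF lin] power2_eq_square field_simps)
    also have "C * (norm x)\<^sup>2 / \<tau> \<le> \<epsilon>"
      using \<tau> \<epsilon> by (simp add: Q_def field_simps)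
    finally show ?thesis by simp
  qed
  moreover have "norm (x - s) \<le> norm (x - p) + norm (s - p)"
    using norm_triangle_ineq4[of "x - p" "s - p"] by simp
  ultimately have xs: "norm (x - s) < real n * r + of_int m * r"
    using s(2) g1 \<tau>r unfolding \<epsilon>_def g1_def by argo
  define M where "M = nat (int n + m)"
  have "int n + m > 0" using n_ge(3) by linarith
  then have M: "M > 0" "real M = real n + of_int m" by (simp_all add: M_def)
  have "norm (k x - k s) < real n * r + of_int m * r"
    using step_map_multiple[OF dense r step x s(1) M(1)] xs by (simp add: M(2) distrib_right)
  moreover have "norm (k y - k s) \<ge> real n * r"
    using step_map_multiple[OF dense r step y s(1) n(2)] ys by simp
  moreover have "norm (k y - k s) - norm (k x - k s) \<le> \<phi>' (k y - k x) + g2 / 2"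
  proof -
    define w where "w = - ((1 / real n) *\<^sub>R k s)"
    have "norm (s - s0) \<le> norm (s - p) + norm (p + real n *\<^sub>R v) + norm (s0 + real n *\<^sub>R v)"
      using norm_triangle_ineq[of "s - p" "p + real n *\<^sub>R v"]
        norm_triangle_ineq4[of "s - p + (p + real n *\<^sub>R v)" "s0 + real n *\<^sub>R v"] by simp
    moreover have "p + real n *\<^sub>R v = (- \<theta>) *\<^sub>R v" by (simp add: p_def \<tau>_def algebra_simps)
    ultimately have "norm (s - s0) \<le> \<epsilon> + \<bar>\<theta>\<bar> * r + 1" using s(2) s0(2) nv by simp
    then have ks: "norm (k s - k s0) \<le> D"
      using step_map_coarse_isometry[OF dense r step s(1) s0(1)] by (simp add: D_def)
    have "real n *\<^sub>R (w - T v) = - ((k s - k s0) + (k s0 + real n *\<^sub>R T v))"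
      using n(2) by (simp add: w_def scaleR_diff_right)
    then have "real n * norm (w - T v) = norm ((k s - k s0) + (k s0 + real n *\<^sub>R T v))"
      by (metis abs_of_nat norm_minus_cancel norm_scaleR)
    also have "\<dots> \<le> D + \<eta> / 2 * real n"
      using norm_triangle_ineq[of "k s - k s0" "k s0 + real n *\<^sub>R T v"] ks s0(3) by linarith
    also have "\<dots> < real n * \<eta>" using n_ge(2) \<eta>(1) by (simp add: field_simps)
    finally have "norm (w - T v) < \<eta>" using n(2) by simp
    from ray[OF this n_ge(1)] show ?thesis using n(2) by (simp add: w_def)
  qed
  ultimately show False
    using g2 unfolding linear_diff[OF lin'] g2_def by argo
qed

text \<open>
  The previous lemma leaves open that points on one level of \<open>\<phi>\<close> are mapped to different levels of
  \<open>\<phi>' = \<phi> \<circ> T\<inverse>\<close>. In that case place a lens, the intersection of two \<open>r\<close>-balls that almost touch in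
  direction \<open>T v\<close>, between the two levels of \<open>\<phi>'\<close>; as \<open>\<phi>'\<close> has norm 1, the whole lens lies between them. The
  preimage of the lens under \<open>k\<close> is an intersection of two \<open>r\<close>-balls with \<open>S\<close> again, so it contains
  points on different levels of \<open>\<phi>\<close>; but monotonicity squeezes it into a single level.
\<close>

lemma step_map_functional_weak_mono:
  assumes \<phi>: "\<phi> \<in> smooth_functionals" and x: "x \<in> S" and y: "y \<in> S" and le: "\<phi> x \<le> \<phi> y"
  shows "\<phi> (inv T (k x)) \<le> \<phi> (inv T (k y))"
proof (rule ccontr)
  assume notle: "\<not> ?thesis"
  define \<phi>' where "\<phi>' z = \<phi> (inv T z)" for z
  obtain v0 where "smooth_at v0 \<phi>" using \<phi> by (auto simp: smooth_functionals_def)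
  define v where "v = (1 / norm v0) *\<^sub>R v0"
  have "v0 \<noteq> 0" using \<open>smooth_at v0 \<phi>\<close> by (simp add: smooth_at_def)
  then have sv: "smooth_at v \<phi>" and nv: "norm v = 1"
    using smooth_at_scale[OF \<open>smooth_at v0 \<phi>\<close>] by (simp_all add: v_def)
  define v' where "v' = T v"
  have sv': "smooth_at v' \<phi>'" unfolding \<phi>'_def v'_def by (rule smooth_at_inv_asymptote[OF sv])
  have nv': "norm v' = 1" by (simp add: v'_def normT nv)
  have \<phi>v: "\<phi> v = 1" "\<phi>' v' = 1" using smooth_at_self[OF sv] smooth_at_self[OF sv'] nv nv' by auto
  interpret L: linear \<phi> by (rule smooth_at_linear[OF sv])
  interpret L': linear \<phi>' by (rule smooth_at_linear[OF sv'])
  have le1: "\<phi> z \<le> norm z" "\<phi>' z \<le> norm z" for z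
    using smooth_at_le_norm[OF sv] smooth_at_le_norm[OF sv'] by auto
  define a b where "a = \<phi>' (k y)" and "b = \<phi>' (k x)"
  have ab: "a < b" using notle by (simp add: a_def b_def \<phi>'_def)
  \<comment> \<open>The centres of the lens are close to the points \<open>p \<plusminus> (r - \<delta>) v'\<close>; on the lens \<open>\<phi>'\<close> varies by less than \<open>3 \<delta>\<close>.\<close>
  define \<delta> where "\<delta> = min ((b - a) / 8) (r / 2)"
  have \<delta>: "\<delta> > 0" "8 * \<delta> \<le> b - a" "\<delta> < r" using ab r by (auto simp: \<delta>_def min_def)
  define p where "p = ((a + b) / 2) *\<^sub>R v'"
  have \<phi>p: "\<phi>' p = (a + b) / 2" by (simp add: p_def L'.scale \<phi>v)
  have bij: "bij_betw k S S" using step by (simp add: step_map_def)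
  have pre: "\<exists>u\<in>S. norm (k u - z) < \<delta> / 2" for z
  proof -
    obtain t where t: "t \<in> S" "norm (t - z) < \<delta> / 2" using dense_approx[OF dense, of "\<delta> / 2" z] \<delta>(1) by auto
    then obtain u where "u \<in> S" "t = k u" using bij by (auto simp: bij_betw_def)
    then show ?thesis using t by blast
  qed
  obtain y1 where y1: "y1 \<in> S" "norm (k y1 - (p - (r - \<delta>) *\<^sub>R v')) < \<delta> / 2" using pre by blast
  obtain y2 where y2: "y2 \<in> S" "norm (k y2 - (p + (r - \<delta>) *\<^sub>R v')) < \<delta> / 2" using pre by blast
  obtain u where u: "u \<in> S" "norm (k u - p) < \<delta> / 2" using pre by blast
  have lens: "a < \<phi>' q \<and> \<phi>' q < b" if "norm (q - k y1) < r" "norm (q - k y2) < r" for q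
  proof -
    have "\<phi>' q - \<phi>' (k y1) < r" "\<phi>' (k y2) - \<phi>' q < r"
      using le1(2)[of "q - k y1"] le1(2)[of "k y2 - q"] that by (simp_all add: L'.diff norm_minus_commute)
    moreover have "\<phi>' (k y1) - (\<phi>' p - (r - \<delta>)) < \<delta> / 2"
      using le1(2)[of "k y1 - (p - (r - \<delta>) *\<^sub>R v')"] y1(2) by (simp add: L'.diff L'.scale \<phi>v)
    moreover have "(\<phi>' p + (r - \<delta>)) - \<phi>' (k y2) < \<delta> / 2"
      using le1(2)[of "(p + (r - \<delta>) *\<^sub>R v') - k y2"] y2(2)
      by (simp add: L'.diff L'.add L'.scale \<phi>v norm_minus_commute)
    ultimately show ?thesis using \<delta> unfolding \<phi>p by argo
  qed
  have nr: "norm ((r - \<delta>) *\<^sub>R v') = r - \<delta>" using \<delta>(3) nv' by simp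
  have "norm (k u - k y1) < r"
  proof -
    have E: "k u - k y1 = (k u - p) + (r - \<delta>) *\<^sub>R v' - (k y1 - (p - (r - \<delta>) *\<^sub>R v'))" by simp
    show ?thesis
      unfolding E using norm_triangle_ineq4[of "(k u - p) + (r - \<delta>) *\<^sub>R v'" "k y1 - (p - (r - \<delta>) *\<^sub>R v')"]
        norm_triangle_ineq[of "k u - p" "(r - \<delta>) *\<^sub>R v'"] u(2) y1(2) nr by argo
  qed
  moreover have "norm (k u - k y2) < r"
  proof -
    have E: "k u - k y2 = (k u - p) - (r - \<delta>) *\<^sub>R v' - (k y2 - (p + (r - \<delta>) *\<^sub>R v'))" by simp
    show ?thesis
      unfolding E using norm_triangle_ineq4[of "(k u - p) - (r - \<delta>) *\<^sub>R v'" "k y2 - (p + (r - \<delta>) *\<^sub>R v')"]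
        norm_triangle_ineq4[of "k u - p" "(r - \<delta>) *\<^sub>R v'"] u(2) y2(2) nr by argo
  qed
  ultimately have ku: "norm (k u - k y1) < r" "norm (k u - k y2) < r" by auto
  have step_iff: "norm (z - w) < r \<longleftrightarrow> norm (k z - k w) < r" if "z \<in> S" "w \<in> S" for z w
    using step that by (simp add: step_map_def)
  define e where "e = min (r - norm (u - y1)) (r - norm (u - y2))"
  have e: "e > 0" using ku step_iff u(1) y1(1) y2(1) by (simp add: e_def)
  obtain w where w: "w \<in> S" "norm (w - (u + (e / 2) *\<^sub>R v)) < e / 4"
    using dense_approx[OF dense, of "e / 4"] e by auto
  have wu: "norm (w - u) < e"
    using norm_triangle_ineq[of "w - (u + (e / 2) *\<^sub>R v)" "(e / 2) *\<^sub>R v"] w(2) nv e by simp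
  have "\<phi> (u + (e / 2) *\<^sub>R v - w) < e / 4"
    using le1(1)[of "u + (e / 2) *\<^sub>R v - w"] w(2) by (simp add: norm_minus_commute)
  then have uw: "\<phi> u < \<phi> w" using e by (simp add: L.diff L.add L.scale \<phi>v)
  have "norm (w - y1) < r" "norm (w - y2) < r"
    using norm_triangle_ineq[of "w - u" "u - y1"] norm_triangle_ineq[of "w - u" "u - y2"] wu
    by (simp_all add: e_def)
  then have "\<phi>' (k w) < b" using lens step_iff w(1) y1(1) y2(1) by blast
  then have "\<not> \<phi> x < \<phi> w"
    using step_map_functional_mono[OF \<phi> x w(1), of 0] by (auto simp: b_def \<phi>'_def)
  moreover have "a < \<phi>' (k u)" using lens ku by blast
  then have "\<not> \<phi> u < \<phi> y"
    using step_map_functional_mono[OF \<phi> u(1) y, of 0] by (auto simp: a_def \<phi>'_def)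
  ultimately show False using uw le by linarith
qed

lemma step_map_functional_factors:
  assumes \<phi>: "\<phi> \<in> smooth_functionals"
  obtains h where "continuous_on UNIV h" "\<And>x. x \<in> S \<Longrightarrow> \<phi> (inv T (k x)) = h (\<phi> x)"
    "\<And>s t m. s < t + of_int m * r \<Longrightarrow> h s \<le> h t + of_int m * r"
proof -
  obtain v where v: "smooth_at v \<phi>" using \<phi> by (auto simp: smooth_functionals_def)
  have bij: "bij_betw k S S" using step by (simp add: step_map_def)
  have dp: "\<exists>x\<in>S. a < \<phi> x \<and> \<phi> x < b" if "a < b" for a b
    using smooth_functionals_dense_values[OF dense v that] by blast
  have dq: "\<exists>x\<in>S. a < \<phi> (inv T (k x)) \<and> \<phi> (inv T (k x)) < b" if ab: "a < b" for a b
  proof -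
    obtain z where "z \<in> S" "a < \<phi> (inv T z)" "\<phi> (inv T z) < b"
      using smooth_functionals_dense_values[OF dense smooth_at_inv_asymptote[OF v] ab] by blast
    moreover obtain x where "x \<in> S" "z = k x" using bij \<open>z \<in> S\<close> by (auto simp: bij_betw_def)
    ultimately show ?thesis by blast
  qed
  obtain h where h: "mono h" "continuous_on UNIV h" "\<And>x. x \<in> S \<Longrightarrow> \<phi> (inv T (k x)) = h (\<phi> x)"
    using monotone_extension[of S \<phi> "\<lambda>x. \<phi> (inv T (k x))"] step_map_functional_weak_mono[OF \<phi>] dp dq
    by blast
  have "h s \<le> h t + of_int m * r" if "s < t + of_int m * r" for s t m
  proof -
    define d where "d = (t + of_int m * r - s) / 3"
    have d: "d > 0" using that by (simp add: d_def)
    obtain x where x: "x \<in> S" "s < \<phi> x" "\<phi> x < s + d" using dp[of s "s + d"] d by auto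
    obtain y where y: "y \<in> S" "t - d < \<phi> y" "\<phi> y < t" using dp[of "t - d" t] d by auto
    have "\<phi> x < \<phi> y + of_int m * r"
      using x(3) y(2) d unfolding d_def by argo
    then have "h (\<phi> x) \<le> h (\<phi> y) + of_int m * r"
      using step_map_functional_mono[OF \<phi> x(1) y(1)] h(3) x(1) y(1) by simp
    moreover have "h s \<le> h (\<phi> x)" "h (\<phi> y) \<le> h t" using h(1) x y by (simp_all add: monoD)
    ultimately show ?thesis by linarith
  qed
  then show ?thesis using that h by blast
qed

end

section \<open>Functionals that depend on others give translations\<close>

text \<open>
  A biorthogonal system: \<open>e\<close> picks for every functional in \<open>F\<close> a vector on which it is 1 and the others
  vanish.
\<close>

definition dual_system :: "('a::real_normed_vector \<Rightarrow> real) set \<Rightarrow> (('a \<Rightarrow> real) \<Rightarrow> 'a) \<Rightarrow> bool" where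
  "dual_system F e \<longleftrightarrow> finite F \<and> (\<forall>\<psi>\<in>F. linear \<psi>) \<and>
     (\<forall>\<psi>\<in>F. \<forall>\<xi>\<in>F. \<psi> (e \<xi>) = (if \<psi> = \<xi> then 1 else 0))"

lemma dual_system_card_le:
  fixes B :: "'a::real_normed_vector set"
  assumes B: "finite B" "span B = UNIV" and F: "dual_system F (e :: _ \<Rightarrow> 'a)"
  shows "card F \<le> card B"
proof -
  have fin: "finite F" and lin: "\<And>\<psi>. \<psi> \<in> F \<Longrightarrow> linear \<psi>"
    and e: "\<And>\<psi> \<xi>. \<psi> \<in> F \<Longrightarrow> \<xi> \<in> F \<Longrightarrow> \<psi> (e \<xi>) = (if \<psi> = \<xi> then 1 else 0)"
    using F by (auto simp: dual_system_def)
  have inj: "inj_on e F"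
    by (rule inj_onI) (metis e zero_neq_one)
  have "independent (e ` F)"
  proof
    assume "dependent (e ` F)"
    then obtain u \<psi> where u: "(\<Sum>v\<in>e ` F. u v *\<^sub>R v) = 0" "\<psi> \<in> F" "u (e \<psi>) \<noteq> 0"
      using dependent_finite[of "e ` F"] fin by auto
    have "0 = \<psi> (\<Sum>\<xi>\<in>F. u (e \<xi>) *\<^sub>R e \<xi>)"
      using u(1) linear_0[OF lin[OF u(2)]] by (simp add: sum.reindex[OF inj])
    also have "\<dots> = (\<Sum>\<xi>\<in>F. u (e \<xi>) * (if \<psi> = \<xi> then 1 else 0))"
      using e[OF u(2)] by (simp add: linear_sum[OF lin[OF u(2)]] linear_scale[OF lin[OF u(2)]] cong: sum.cong)
    also have "\<dots> = (\<Sum>\<xi>\<in>F. if \<psi> = \<xi> then u (e \<xi>) else 0)" by (intro sum.cong) auto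
    also have "\<dots> = u (e \<psi>)" using fin u(2) by simp
    finally show False using u(3) by simp
  qed
  then show ?thesis
    using independent_span_bound[OF B(1), of "e ` F"] B(2) card_image[OF inj] by simp
qed

text \<open>
  A biorthogonal system within \<open>\<Psi>\<close> of maximal size has the same common kernel as \<open>\<Psi>\<close>, as it could be
  extended otherwise. The coefficients of \<open>\<phi>\<close> are then read off at the dual vectors.
\<close>

lemma kernel_inclusion_finite_expansion:
  assumes fd: "\<exists>B :: 'a::real_normed_vector set. finite B \<and> span B = UNIV"
    and lin: "\<And>\<psi>. \<psi> \<in> \<Psi> \<Longrightarrow> linear (\<psi> :: 'a \<Rightarrow> real)" and \<phi>: "linear \<phi>"
    and ker: "\<And>z. (\<And>\<psi>. \<psi> \<in> \<Psi> \<Longrightarrow> \<psi> z = 0) \<Longrightarrow> \<phi> z = 0"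
  shows "\<exists>F e. F \<subseteq> \<Psi> \<and> dual_system F e \<and> (\<forall>x. \<phi> x = (\<Sum>\<psi>\<in>F. \<phi> (e \<psi>) * \<psi> x))"
proof -
  obtain B :: "'a set" where B: "finite B" "span B = UNIV" using fd by blast
  define P where "P = (\<lambda>(F, e). F \<subseteq> \<Psi> \<and> dual_system F e)"
  have "P ({}, \<lambda>_. 0)" by (simp add: P_def dual_system_def)
  moreover have "\<forall>y. P y \<longrightarrow> card (fst y) < Suc (card B)"
    using dual_system_card_le[OF B] by (auto simp: P_def less_Suc_eq_le)
  ultimately have "\<exists>x. P x \<and> (\<forall>y. P y \<longrightarrow> card (fst y) \<le> card (fst x))"
    by (rule ex_has_greatest_nat)
  then obtain Fe where Fe: "P Fe" "\<forall>y. P y \<longrightarrow> card (fst y) \<le> card (fst Fe)"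
    by blast
  obtain F e where F_e: "Fe = (F, e)" by (cases Fe)
  have F: "F \<subseteq> \<Psi>" "dual_system F e" using Fe(1) by (auto simp: P_def F_e)
  have maxF: "card F' \<le> card F" if "F' \<subseteq> \<Psi>" "dual_system F' e'" for F' e'
    using Fe(2)[rule_format, of "(F', e')"] that by (simp add: P_def F_e)
  have fin: "finite F"
    and e: "\<And>\<psi> \<xi>. \<psi> \<in> F \<Longrightarrow> \<xi> \<in> F \<Longrightarrow> \<psi> (e \<xi>) = (if \<psi> = \<xi> then 1 else 0)"
    using F(2) by (auto simp: dual_system_def)
  have kerF: "\<psi> z = 0" if z: "\<And>\<xi>. \<xi> \<in> F \<Longrightarrow> \<xi> z = 0" and \<psi>: "\<psi> \<in> \<Psi>" for \<psi> z
  proof (rule ccontr)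
    assume nz: "\<psi> z \<noteq> 0"
    then have notin: "\<psi> \<notin> F" using z by blast
    interpret L: linear \<psi> by (rule lin[OF \<psi>])
    define w where "w = (1 / \<psi> z) *\<^sub>R z"
    have w: "\<psi> w = 1" "\<And>\<xi>. \<xi> \<in> F \<Longrightarrow> \<xi> w = 0"
      using nz z F(1) lin by (auto simp: w_def L.scale linear_scale subset_iff)
    define e' where "e' \<xi> = (if \<xi> = \<psi> then w else e \<xi> - \<psi> (e \<xi>) *\<^sub>R w)" for \<xi>
    have "dual_system (insert \<psi> F) e'"
      unfolding dual_system_def
    proof (intro conjI ballI)
      show "finite (insert \<psi> F)" using fin by simp
      show "linear \<xi>" if "\<xi> \<in> insert \<psi> F" for \<xi> using that lin \<psi> F(1) by blast
      fix \<alpha> \<beta> assume ab: "\<alpha> \<in> insert \<psi> F" "\<beta> \<in> insert \<psi> F"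
      then have la: "linear \<alpha>" using lin \<psi> F(1) by blast
      show "\<alpha> (e' \<beta>) = (if \<alpha> = \<beta> then 1 else 0)"
      proof (cases "\<beta> = \<psi>")
        case True
        then show ?thesis using ab notin w by (auto simp: e'_def)
      next
        case False
        then have "\<alpha> (e' \<beta>) = \<alpha> (e \<beta>) - \<psi> (e \<beta>) * \<alpha> w"
          by (simp add: e'_def linear_diff[OF la] linear_scale[OF la])
        moreover have "\<beta> \<in> F" using ab False by blast
        ultimately show ?thesis
          using ab False w e[of \<alpha> \<beta>] by (cases "\<alpha> = \<psi>") auto
      qed
    qed
    then have "card (insert \<psi> F) \<le> card F" using maxF[of "insert \<psi> F" e'] F(1) \<psi> by blast
    then show False using fin notin by simp
  qed
  have "\<phi> x = (\<Sum>\<psi>\<in>F. \<phi> (e \<psi>) * \<psi> x)" for x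
  proof -
    define y where "y = x - (\<Sum>\<psi>\<in>F. \<psi> x *\<^sub>R e \<psi>)"
    have "\<xi> y = 0" if "\<xi> \<in> F" for \<xi>
    proof -
      have la: "linear \<xi>" using lin F(1) that by blast
      have "\<xi> (\<Sum>\<psi>\<in>F. \<psi> x *\<^sub>R e \<psi>) = (\<Sum>\<psi>\<in>F. \<psi> x * \<xi> (e \<psi>))"
        by (simp add: linear_sum[OF la] linear_scale[OF la])
      also have "\<dots> = (\<Sum>\<psi>\<in>F. if \<xi> = \<psi> then \<psi> x else 0)"
        using e[OF that] by (intro sum.cong) auto
      finally show ?thesis using fin that by (simp add: y_def linear_diff[OF la])
    qed
    then have "\<phi> y = 0" using ker kerF by blast
    then show ?thesis
      by (simp add: y_def linear_diff[OF \<phi>] linear_sum[OF \<phi>] linear_scale[OF \<phi>] mult.commute)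
  qed
  then show ?thesis using F by blast
qed

text \<open>
  Smooth functionals have norm 1.
\<close>

lemma smooth_functional_proportional:
  assumes "\<phi> \<in> smooth_functionals" "\<psi> \<in> smooth_functionals" "\<And>x. \<phi> x = c * \<psi> x"
  shows "\<phi> = \<psi> \<or> \<phi> = (\<lambda>x. - \<psi> x)"
proof -
  obtain u v where uv: "smooth_at u \<phi>" "smooth_at v \<psi>" using assms by (auto simp: smooth_functionals_def)
  have nz: "norm u > 0" "norm v > 0" using uv by (auto simp: smooth_at_def)
  have "norm u \<le> \<bar>c\<bar> * norm u"
  proof -
    have "norm u = \<bar>c\<bar> * \<bar>\<psi> u\<bar>" using smooth_at_self[OF uv(1)] assms(3)[of u] by (simp flip: abs_mult)
    then show ?thesis using smooth_at_abs_le_norm[OF uv(2), of u] by (simp add: mult_left_mono)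
  qed
  moreover have "\<bar>c\<bar> * norm v \<le> norm v"
    using smooth_at_abs_le_norm[OF uv(1), of v] smooth_at_self[OF uv(2)] assms(3)[of v] by (simp add: abs_mult)
  ultimately have "\<bar>c\<bar> = 1" using nz by auto
  then have "c = 1 \<or> c = -1" by linarith
  then show ?thesis using assms(3) by (auto simp: fun_eq_iff)
qed

text \<open>
  The function \<open>h\<close> is affine, and any slope other than 1 would violate the bounds for large shifts.
\<close>

lemma translation_if_additive_and_shift_bounded:
  assumes cont: "continuous_on UNIV h" and add: "\<And>s t. h (s + t) + h 0 = h s + h (t :: real)"
    and r: "r > 0"
    and shift: "\<And>s t m. s < t + of_int m * r \<Longrightarrow> h s \<le> h t + of_int m * (r :: real)"
  shows "h t = t + h 0"
proof -
  define f where "f t = h t - h 0" for t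
  have f: "f t = t * f 1" for t
    using additive_continuous_real[of f t] add cont
    by (simp add: f_def continuous_intros algebra_simps)
  define \<alpha> where "\<alpha> = f 1"
  have up: "\<alpha> * (of_int m - 1) \<le> of_int m" for m :: int
  proof -
    have "f ((of_int m - 1) * r) \<le> of_int m * r"
      using shift[of "(of_int m - 1) * r" 0 m] r by (simp add: f_def algebra_simps)
    then have "(\<alpha> * (of_int m - 1)) * r \<le> of_int m * r"
      using f[of "(of_int m - 1) * r"] by (simp add: \<alpha>_def algebra_simps)
    then show ?thesis using r by simp
  qed
  \<comment> \<open>The shifts by \<open>n + 1\<close> and \<open>1 - n\<close> bound the slope from above and from below.\<close>
  have "real n * \<bar>\<alpha> - 1\<bar> \<le> 1" for n :: nat
    using up[of "int n + 1"] up[of "1 - int n"] by (simp add: abs_if algebra_simps)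
  then have "\<bar>\<alpha> - 1\<bar> = 0"
    by (metis abs_ge_zero abs_of_nonneg ex_less_of_nat_mult less_eq_real_def not_le)
  then show ?thesis using f[of t] by (simp add: f_def \<alpha>_def)
qed

context
  fixes S :: "'a::real_normed_vector set" and r :: real and k T :: "'a \<Rightarrow> 'a"
  assumes fd: "\<exists>B :: 'a set. finite B \<and> span B = UNIV"
    and dense: "closure S = UNIV" and r: "r > 0" and step: "step_map r S k"
    and asym: "asymptotic_to S k T" and linT: "linear T" and bijT: "bij T"
    and normT: "\<And>x. norm (T x) = norm x"
begin

text \<open>
  The condition on \<open>\<phi>\<close> says that \<open>\<phi>\<close> is a linear combination of smooth functionals other than
  \<open>\<phi>\<close> and \<open>-\<phi>\<close>. At least two of them occur, since proportional smooth functionals agree up to sign. The same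
  linear relation holds between the reparametrisations \<open>h\<close> of these functionals. Moving
  along the dual vectors of two of the functionals changes their arguments independently, so that
  \<open>h \<phi> (s + t)\<close> splits into a function of \<open>s\<close> and a function of \<open>t\<close>.
\<close>

lemma step_map_functional_translation:
  assumes \<phi>: "\<phi> \<in> smooth_functionals"
    and ker: "\<And>z. (\<And>\<psi>. \<psi> \<in> smooth_functionals \<Longrightarrow> \<psi> \<noteq> \<phi> \<Longrightarrow> \<psi> \<noteq> (\<lambda>x. - \<phi> x) \<Longrightarrow> \<psi> z = 0) \<Longrightarrow> \<phi> z = 0"
    and xy: "x \<in> S" "y \<in> S"
  shows "\<phi> (inv T (k x)) - \<phi> (inv T (k y)) = \<phi> x - \<phi> y"
proof -
  note factors = step_map_functional_factors[OF dense r step asym linT bijT normT]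
  have lin: "linear \<psi>" if "\<psi> \<in> smooth_functionals" for \<psi> :: "'a \<Rightarrow> real"
    using that smooth_at_linear by (auto simp: smooth_functionals_def)
  have cont: "continuous_on UNIV \<psi>" if \<psi>: "\<psi> \<in> smooth_functionals" for \<psi> :: "'a \<Rightarrow> real"
  proof -
    obtain v where v: "smooth_at v \<psi>" using \<psi> by (auto simp: smooth_functionals_def)
    have "bounded_linear \<psi>"
      using smooth_at_abs_le_norm[OF v] lin[OF \<psi>]
      by (intro bounded_linear_intro[of _ 1]) (auto simp: linear_add linear_scale)
    then show ?thesis by (rule linear_continuous_on)
  qed
  define \<Psi> where "\<Psi> = {\<psi> \<in> smooth_functionals. \<psi> \<noteq> \<phi> \<and> \<psi> \<noteq> (\<lambda>x. - \<phi> x)}"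
  have lin\<Psi>: "linear \<psi>" if "\<psi> \<in> \<Psi>" for \<psi> using that lin by (simp add: \<Psi>_def)
  have ker\<Psi>: "\<phi> z = 0" if "\<And>\<psi>. \<psi> \<in> \<Psi> \<Longrightarrow> \<psi> z = 0" for z
    using that by (intro ker) (simp add: \<Psi>_def)
  obtain F e where F: "F \<subseteq> \<Psi>" and dual: "dual_system F e" and exp: "\<And>x. \<phi> x = (\<Sum>\<psi>\<in>F. \<phi> (e \<psi>) * \<psi> x)"
    using kernel_inclusion_finite_expansion[OF fd lin\<Psi> lin[OF \<phi>] ker\<Psi>] by blast
  have fin: "finite F"
    and e: "\<And>\<psi> \<xi>. \<psi> \<in> F \<Longrightarrow> \<xi> \<in> F \<Longrightarrow> \<psi> (e \<xi>) = (if \<psi> = \<xi> then 1 else 0)"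
    using dual by (auto simp: dual_system_def)
  have F_smooth: "\<psi> \<in> smooth_functionals" if "\<psi> \<in> F" for \<psi> using F that by (auto simp: \<Psi>_def)
  have "\<exists>\<psi>1\<in>F. \<phi> (e \<psi>1) \<noteq> 0"
  proof (rule ccontr)
    assume "\<not> ?thesis"
    then have z: "\<phi> x = 0" for x using exp[of x] by simp
    obtain v where v: "smooth_at v \<phi>" using \<phi> by (auto simp: smooth_functionals_def)
    then show False using smooth_at_self[OF v] z[of v] by (simp add: smooth_at_def)
  qed
  then obtain \<psi>1 where \<psi>1: "\<psi>1 \<in> F" "\<phi> (e \<psi>1) \<noteq> 0" by blast
  have "\<exists>\<psi>2\<in>F. \<psi>2 \<noteq> \<psi>1 \<and> \<phi> (e \<psi>2) \<noteq> 0"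
  proof (rule ccontr)
    assume "\<not> ?thesis"
    then have "(\<Sum>\<psi>\<in>F. \<phi> (e \<psi>) * \<psi> x) = (\<Sum>\<psi>\<in>F. if \<psi> = \<psi>1 then \<phi> (e \<psi>1) * \<psi>1 x else 0)" for x
      by (intro sum.cong) auto
    then have "\<phi> x = \<phi> (e \<psi>1) * \<psi>1 x" for x using exp[of x] fin \<psi>1 by simp
    then have "\<phi> = \<psi>1 \<or> \<phi> = (\<lambda>x. - \<psi>1 x)"
      using smooth_functional_proportional[OF \<phi> F_smooth[OF \<psi>1(1)]] by blast
    then have "\<psi>1 = \<phi> \<or> \<psi>1 = (\<lambda>x. - \<phi> x)" by auto
    then show False using F \<psi>1(1) by (auto simp: \<Psi>_def)
  qed
  then obtain \<psi>2 where \<psi>2: "\<psi>2 \<in> F" "\<psi>2 \<noteq> \<psi>1" "\<phi> (e \<psi>2) \<noteq> 0" by blast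
  have "\<forall>\<psi>\<in>smooth_functionals. \<exists>h. continuous_on UNIV h \<and> (\<forall>x\<in>S. \<psi> (inv T (k x)) = h (\<psi> x)) \<and>
      (\<forall>s t m. s < t + of_int m * r \<longrightarrow> h s \<le> h t + of_int m * r)"
    using factors by metis
  then obtain h where h: "\<And>\<psi>. \<psi> \<in> smooth_functionals \<Longrightarrow> continuous_on UNIV (h \<psi>)"
    "\<And>\<psi> x. \<psi> \<in> smooth_functionals \<Longrightarrow> x \<in> S \<Longrightarrow> \<psi> (inv T (k x)) = h \<psi> (\<psi> x)"
    "\<And>\<psi> s t m. \<psi> \<in> smooth_functionals \<Longrightarrow> s < t + of_int m * r \<Longrightarrow> h \<psi> s \<le> h \<psi> t + of_int m * r"
    by metis
  have eq: "h \<phi> (\<phi> z) = (\<Sum>\<psi>\<in>F. \<phi> (e \<psi>) * h \<psi> (\<psi> z))" for z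
  proof -
    have "continuous_on UNIV (\<lambda>z. h \<psi> (\<psi> z))" if "\<psi> \<in> smooth_functionals" for \<psi>
      using that h(1) cont by (metis continuous_on_compose2 subset_UNIV)
    then have "closed {z. h \<phi> (\<phi> z) = (\<Sum>\<psi>\<in>F. \<phi> (e \<psi>) * h \<psi> (\<psi> z))}"
      using F_smooth \<phi> by (intro closed_Collect_eq continuous_intros) auto
    moreover have "S \<subseteq> {z. h \<phi> (\<phi> z) = (\<Sum>\<psi>\<in>F. \<phi> (e \<psi>) * h \<psi> (\<psi> z))}"
    proof safe
      fix x assume x: "x \<in> S"
      have "h \<phi> (\<phi> x) = (\<Sum>\<psi>\<in>F. \<phi> (e \<psi>) * \<psi> (inv T (k x)))"
        using h(2)[OF \<phi> x] exp[of "inv T (k x)"] by simp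
      also have "\<dots> = (\<Sum>\<psi>\<in>F. \<phi> (e \<psi>) * h \<psi> (\<psi> x))"
        using h(2)[OF F_smooth x] by (intro sum.cong) auto
      finally show "h \<phi> (\<phi> x) = (\<Sum>\<psi>\<in>F. \<phi> (e \<psi>) * h \<psi> (\<psi> x))" .
    qed
    ultimately have "closure S \<subseteq> {z. h \<phi> (\<phi> z) = (\<Sum>\<psi>\<in>F. \<phi> (e \<psi>) * h \<psi> (\<psi> z))}"
      by (rule closure_minimal[rotated])
    then show ?thesis using dense by auto
  qed
  have add: "h \<phi> (s + t) + h \<phi> 0 = h \<phi> s + h \<phi> t" for s t
  proof -
    define u where "u = (s / \<phi> (e \<psi>1)) *\<^sub>R e \<psi>1"
    define w where "w = (t / \<phi> (e \<psi>2)) *\<^sub>R e \<psi>2"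
    have "\<phi> u = s" "\<phi> w = t"
      using \<psi>1(2) \<psi>2(3) by (simp_all add: u_def w_def linear_scale[OF lin[OF \<phi>]])
    then have vals: "h \<phi> (s + t) = h \<phi> (\<phi> (u + w))" "h \<phi> 0 = h \<phi> (\<phi> 0)"
      "h \<phi> s = h \<phi> (\<phi> u)" "h \<phi> t = h \<phi> (\<phi> w)"
      by (simp_all add: linear_add[OF lin[OF \<phi>]] linear_0[OF lin[OF \<phi>]])
    have "h \<psi> (\<psi> (u + w)) + h \<psi> (\<psi> 0) = h \<psi> (\<psi> u) + h \<psi> (\<psi> w)" if \<psi>: "\<psi> \<in> F" for \<psi>
    proof -
      note l = lin[OF F_smooth[OF \<psi>]]
      have "\<psi> u = 0 \<or> \<psi> w = 0"
        using e[OF \<psi> \<psi>1(1)] e[OF \<psi> \<psi>2(1)] \<psi>2(2) by (auto simp: u_def w_def linear_scale[OF l])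
      then show ?thesis by (auto simp: linear_add[OF l] linear_0[OF l])
    qed
    then have "(\<Sum>\<psi>\<in>F. \<phi> (e \<psi>) * (h \<psi> (\<psi> (u + w)) + h \<psi> (\<psi> 0))) =
      (\<Sum>\<psi>\<in>F. \<phi> (e \<psi>) * (h \<psi> (\<psi> u) + h \<psi> (\<psi> w)))"
      by (intro sum.cong) auto
    then show ?thesis
      unfolding vals eq by (simp add: distrib_left sum.distrib)
  qed
  have "h \<phi> t = t + h \<phi> 0" for t
    using translation_if_additive_and_shift_bounded[OF h(1)[OF \<phi>] add r] h(3)[OF \<phi>] by blast
  then show ?thesis using h(2)[OF \<phi> xy(1)] h(2)[OF \<phi> xy(2)] by (metis add_diff_cancel_right)
qed

end

section \<open>Enlarging the \<open>\<ell>\<^sub>\<infinity>\<close>-summand\<close>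

lemma max_direct_sum_commute:
  assumes "max_direct_sum U W" shows "max_direct_sum W U"
  unfolding max_direct_sum_def
proof (intro conjI allI ballI)
  note D = assms[unfolded max_direct_sum_def]
  show "subspace W" using D by (elim conjE)
  show "subspace U" using D by (elim conjE)
  show "W \<inter> U = {0}" using D by (subst Int_commute) (elim conjE)
  show "\<exists>u\<in>W. \<exists>w\<in>U. x = u + w" for x
  proof -
    obtain u w where "u \<in> U" "w \<in> W" "x = u + w" using D by blast
    then show ?thesis by (metis add.commute)
  qed
  show "norm (w + u) = max (norm w) (norm u)" if "w \<in> W" "u \<in> U" for w u
    using D that by (metis add.commute max.commute)
qed

text \<open>
  At a smooth point close to \<open>w\<close> the \<open>W\<close>-component dominates the norm, so small moves in \<open>U\<close> leave the norm
  unchanged and the derivative vanishes on \<open>U\<close>.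
\<close>

lemma summand_supporting_functional:
  fixes w :: "'a::real_normed_vector"
  assumes fd: "\<exists>B :: 'a set. finite B \<and> span B = UNIV"
    and sum: "max_direct_sum U W" and w: "w \<in> W" "w \<noteq> 0"
  obtains \<phi> where "\<phi> \<in> smooth_functionals" "\<And>u. u \<in> U \<Longrightarrow> \<phi> u = 0" "\<phi> w \<noteq> 0"
proof -
  have sU: "subspace U" and sW: "subspace W" and dec: "\<And>x. \<exists>u\<in>U. \<exists>w\<in>W. x = u + w"
    and nrm: "\<And>u w. u \<in> U \<Longrightarrow> w \<in> W \<Longrightarrow> norm (u + w) = max (norm u) (norm w)"
    using sum by (auto simp: max_direct_sum_def)
  obtain v \<phi> where v: "smooth_at v \<phi>" "norm (v - w) < norm w / 4"
    using smooth_points_dense[OF fd w(2), of "norm w / 4"] w(2) by auto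
  obtain u1 w1 where uw: "u1 \<in> U" "w1 \<in> W" "v = u1 + w1" using dec by blast
  have nw: "norm w > 0" using w(2) by simp
  have vw: "v - w = u1 + (w1 - w)" using uw by simp
  have "norm (v - w) = max (norm u1) (norm (w1 - w))"
    unfolding vw by (rule nrm[OF uw(1) subspace_diff[OF sW uw(2) w(1)]])
  then have small: "norm u1 < norm w / 4" "norm (w1 - w) < norm w / 4" using v(2) by auto
  have big: "norm w1 > norm w / 2"
    using norm_triangle_sub[of w w1] small(2) nw unfolding norm_minus_commute[of w w1] by linarith
  have "norm u1 \<le> norm w1" using small(1) big nw by linarith
  then have nv: "norm v = norm w1" using nrm[OF uw(1,2)] uw(3) by (simp add: max_absorb2)
  have vanish: "\<phi> u \<le> 0" if u: "u \<in> U" for u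
  proof -
    define c where "c = norm u + 1"
    have c: "c > 0" "norm u \<le> c" by (simp_all add: c_def add_nonneg_pos)
    define t where "t = (norm w / 4) / c"
    have t: "t > 0" using nw c(1) by (simp add: t_def)
    have "t * norm u \<le> t * c" using t c by simp
    moreover have "t * c = norm w / 4" using c(1) by (simp add: t_def)
    moreover have "norm (t *\<^sub>R u) = t * norm u" using t by simp
    ultimately have "norm (u1 + t *\<^sub>R u) < norm w1"
      using norm_triangle_ineq[of u1 "t *\<^sub>R u"] small(1) big by linarith
    moreover have "u1 + t *\<^sub>R u \<in> U" using sU uw(1) u by (simp add: subspace_add subspace_scale)
    then have "norm ((u1 + t *\<^sub>R u) + w1) = max (norm (u1 + t *\<^sub>R u)) (norm w1)" using nrm uw(2) by blast
    ultimately have "norm ((u1 + t *\<^sub>R u) + w1) = norm v" using nv by simp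
    then have "norm (v + t *\<^sub>R u) = norm v" using uw(3) by (simp add: algebra_simps)
    then have "\<phi> (t *\<^sub>R u) \<le> 0" using smooth_at_support[OF v(1), of "t *\<^sub>R u"] by simp
    then show ?thesis
      using t by (simp add: linear_scale[OF smooth_at_linear[OF v(1)]] mult_le_0_iff)
  qed
  have "\<phi> u = 0" if "u \<in> U" for u
    using vanish[OF that] vanish[OF subspace_neg[OF sU that]] linear_neg[OF smooth_at_linear[OF v(1)], of u]
    by simp
  moreover have "\<phi> w > 0" using smooth_near_value[OF v(1), of w] v(2) nw by linarith
  ultimately show ?thesis using that v(1) by (fastforce simp: smooth_functionals_def)
qed

lemma linf_norm_Suc: "linf_norm (Suc d) x = max \<bar>x d\<bar> (linf_norm d x)"
proof -
  have "insert 0 ((\<lambda>i. \<bar>x i\<bar>) ` {..<Suc d}) = insert \<bar>x d\<bar> (insert 0 ((\<lambda>i. \<bar>x i\<bar>) ` {..<d}))"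
    by (auto simp: lessThan_Suc)
  then show ?thesis by (simp add: linf_norm_def)
qed

lemma linf_norm_cong: "(\<And>i. i < d \<Longrightarrow> x i = y i) \<Longrightarrow> linf_norm d x = linf_norm d y"
  unfolding linf_norm_def by (metis (no_types, lifting) image_cong lessThan_iff)

text \<open>
  The coordinate function \<open>\<phi>\<close> becomes the additional last coordinate.
\<close>

lemma linf_isometry_extend:
  fixes e :: "'a::real_normed_vector"
  assumes T: "linf_isometry T W d" and \<phi>: "linear \<phi>" "\<And>w. w \<in> W \<Longrightarrow> \<phi> w = 0" and e: "\<phi> e = 1"
    and nrm: "\<And>w t. w \<in> W \<Longrightarrow> norm (w + t *\<^sub>R e) = max (norm w) \<bar>t\<bar>"
  shows "linf_isometry (\<lambda>x i. T (x - \<phi> x *\<^sub>R e) i + (if i = d then \<phi> x else 0))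
    {w + t *\<^sub>R e | w t. w \<in> W} (Suc d)"
    (is "linf_isometry _ ?W _")
proof -
  define T1 where "T1 = (\<lambda>x i. T (x - \<phi> x *\<^sub>R e) i + (if i = d then \<phi> x else 0))"
  have sW: "subspace W" and bij: "bij_betw T W (linf_carrier d)"
    and add: "\<And>x y i. x \<in> W \<Longrightarrow> y \<in> W \<Longrightarrow> T (x + y) i = T x i + T y i"
    and scale: "\<And>c x i. x \<in> W \<Longrightarrow> T (c *\<^sub>R x) i = c * T x i"
    and norm: "\<And>x. x \<in> W \<Longrightarrow> linf_norm d (T x) = norm x"
    using T by (auto simp: linf_isometry_def)
  have \<phi>t: "\<phi> (w + t *\<^sub>R e) = t" if "w \<in> W" for w t
    using that \<phi>(2) e by (simp add: linear_add[OF \<phi>(1)] linear_scale[OF \<phi>(1)])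
  have val: "T1 (w + t *\<^sub>R e) = (\<lambda>i. T w i + (if i = d then t else 0))" if "w \<in> W" for w t
    unfolding T1_def \<phi>t[OF that] by simp
  have zero: "T w i = 0" if "w \<in> W" "i \<ge> d" for w i
    using bij that by (auto simp: bij_betw_def linf_carrier_def)
  have "subspace ?W"
  proof (rule subspaceI)
    show "0 \<in> ?W" using subspace_0[OF sW] by (auto intro!: exI[of _ 0])
    show "x + y \<in> ?W" if xy: "x \<in> ?W" "y \<in> ?W" for x y
    proof -
      obtain w t w' t' where "w \<in> W" "w' \<in> W" "x = w + t *\<^sub>R e" "y = w' + t' *\<^sub>R e" using xy by blast
      then have "x + y = (w + w') + (t + t') *\<^sub>R e" "w + w' \<in> W"
        using sW by (simp_all add: algebra_simps subspace_add)
      then show ?thesis by blast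
    qed
    show "c *\<^sub>R x \<in> ?W" if x: "x \<in> ?W" for c x
    proof -
      obtain w t where "w \<in> W" "x = w + t *\<^sub>R e" using x by blast
      then have "c *\<^sub>R x = c *\<^sub>R w + (c * t) *\<^sub>R e" "c *\<^sub>R w \<in> W"
        using sW by (simp_all add: algebra_simps subspace_scale)
      then show ?thesis by blast
    qed
  qed
  moreover have "bij_betw T1 ?W (linf_carrier (Suc d))"
    unfolding bij_betw_def
  proof
    show "inj_on T1 ?W"
    proof (rule inj_onI)
      fix x y assume xy: "x \<in> ?W" "y \<in> ?W" and eq: "T1 x = T1 y"
      obtain w t w' t' where w: "w \<in> W" "w' \<in> W" and x: "x = w + t *\<^sub>R e" "y = w' + t' *\<^sub>R e" using xy by blast
      have pt: "T w i + (if i = d then t else 0) = T w' i + (if i = d then t' else 0)" for i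
        using eq unfolding x val[OF w(1)] val[OF w(2)] by meson
      have t: "t = t'" using pt[of d] zero[OF w(1), of d] zero[OF w(2), of d] by simp
      then have "T w = T w'" using pt by auto
      then have "w = w'" using bij w by (auto simp: bij_betw_def inj_on_def)
      then show "x = y" using x t by simp
    qed
    show "T1 ` ?W = linf_carrier (Suc d)"
    proof
      show "T1 ` ?W \<subseteq> linf_carrier (Suc d)"
      proof
        fix y assume "y \<in> T1 ` ?W"
        then obtain w t where w: "w \<in> W" "y = T1 (w + t *\<^sub>R e)" by blast
        show "y \<in> linf_carrier (Suc d)"
          unfolding w(2) val[OF w(1)] using zero[OF w(1)] by (simp add: linf_carrier_def)
      qed
      show "linf_carrier (Suc d) \<subseteq> T1 ` ?W"
      proof
        fix y assume y: "y \<in> linf_carrier (Suc d)"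
        then have "y(d := 0) \<in> linf_carrier d" by (auto simp: linf_carrier_def)
        then obtain w where w: "w \<in> W" "T w = y(d := 0)" using bij by (metis bij_betw_imp_surj_on imageE)
        then have "y = T1 (w + y d *\<^sub>R e)" unfolding val[OF w(1)] by auto
        then show "y \<in> T1 ` ?W" using w(1) by blast
      qed
    qed
  qed
  moreover have "T1 (x + y) i = T1 x i + T1 y i" if xy: "x \<in> ?W" "y \<in> ?W" for x y i
  proof -
    obtain w t w' t' where w: "w \<in> W" "w' \<in> W" and x: "x = w + t *\<^sub>R e" "y = w' + t' *\<^sub>R e" using xy by blast
    have "x + y = (w + w') + (t + t') *\<^sub>R e" by (simp add: x algebra_simps)
    then have "T1 (x + y) = (\<lambda>i. T (w + w') i + (if i = d then t + t' else 0))"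
      using val[OF subspace_add[OF sW w]] by presburger
    then show ?thesis unfolding x val[OF w(1)] val[OF w(2)] using add[OF w] by simp
  qed
  moreover have "T1 (c *\<^sub>R x) i = c * T1 x i" if x: "x \<in> ?W" for c x i
  proof -
    obtain w t where w: "w \<in> W" and x: "x = w + t *\<^sub>R e" using x by blast
    have "c *\<^sub>R x = c *\<^sub>R w + (c * t) *\<^sub>R e" by (simp add: x algebra_simps)
    then have "T1 (c *\<^sub>R x) = (\<lambda>i. T (c *\<^sub>R w) i + (if i = d then c * t else 0))"
      using val[OF subspace_scale[OF sW w]] by presburger
    then show ?thesis unfolding x val[OF w] using scale[OF w] by (simp add: distrib_left)
  qed
  moreover have "linf_norm (Suc d) (T1 x) = norm x" if x: "x \<in> ?W" for x
  proof -
    obtain w t where w: "w \<in> W" and x: "x = w + t *\<^sub>R e" using x by blast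
    have "linf_norm d (\<lambda>i. T w i + (if i = d then t else 0)) = linf_norm d (T w)"
      by (rule linf_norm_cong) simp
    then show ?thesis
      unfolding x val[OF w] linf_norm_Suc nrm[OF w] using zero[OF w, of d] norm[OF w] by (simp add: max.commute)
  qed
  ultimately have "linf_isometry T1 ?W (Suc d)" unfolding linf_isometry_def by blast
  then show ?thesis by (simp only: T1_def)
qed

text \<open>
  Normalise \<open>z\<close> to \<open>e\<close> with \<open>\<phi> e = 1\<close>. Functionals living on \<open>W\<close> do not see \<open>e\<close>, so \<open>e \<in> U\<close>. On \<open>U\<close>, the norm is
  the maximum of \<open>\<bar>\<phi>\<bar>\<close> and the supremum of the other smooth functionals, which ignore \<open>e\<close>; hence \<open>U\<close> is
  the \<open>\<ell>\<^sub>\<infinity>\<close>-sum of the kernel of \<open>\<phi>\<close> and the line through \<open>e\<close>, and this line can be moved to \<open>W\<close>.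
\<close>

lemma isolated_functional_enlarges_summand:
  fixes z :: "'a::real_normed_vector"
  assumes fd: "\<exists>B :: 'a set. finite B \<and> span B = UNIV"
    and sum: "max_direct_sum U W" and T: "linf_isometry T W d"
    and \<phi>: "\<phi> \<in> smooth_functionals" "\<And>w. w \<in> W \<Longrightarrow> \<phi> w = 0"
    and z: "\<phi> z \<noteq> 0" "\<And>\<psi>. \<psi> \<in> smooth_functionals \<Longrightarrow> \<psi> \<noteq> \<phi> \<Longrightarrow> \<psi> \<noteq> (\<lambda>x. - \<phi> x) \<Longrightarrow> \<psi> z = 0"
  shows "\<exists>W'. linf_summand W' \<and> W \<subset> W'"
proof -
  have sU: "subspace U" and sW: "subspace W" and UW: "U \<inter> W = {0}" and dec: "\<And>x. \<exists>u\<in>U. \<exists>w\<in>W. x = u + w"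
    and nrm: "\<And>u w. u \<in> U \<Longrightarrow> w \<in> W \<Longrightarrow> norm (u + w) = max (norm u) (norm w)"
    using sum by (auto simp: max_direct_sum_def)
  obtain v where v: "smooth_at v \<phi>" using \<phi>(1) by (auto simp: smooth_functionals_def)
  note lin = smooth_at_linear[OF v]
  have lin': "linear \<psi>" if "\<psi> \<in> smooth_functionals" for \<psi> :: "'a \<Rightarrow> real"
    using that smooth_at_linear by (auto simp: smooth_functionals_def)
  define e where "e = (1 / \<phi> z) *\<^sub>R z"
  have \<phi>e: "\<phi> e = 1" using z(1) by (simp add: e_def linear_scale[OF lin])
  have \<psi>e: "\<psi> e = 0" if "\<psi> \<in> smooth_functionals" "\<psi> \<noteq> \<phi>" "\<psi> \<noteq> (\<lambda>x. - \<phi> x)" for \<psi>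
    using z(2)[OF that] by (simp add: e_def linear_scale[OF lin'[OF that(1)]])
  have eU: "e \<in> U"
  proof -
    obtain u w where uw: "u \<in> U" "w \<in> W" "e = u + w" using dec by blast
    have "w = 0"
    proof (rule ccontr)
      assume "w \<noteq> 0"
      then obtain \<psi> where \<psi>: "\<psi> \<in> smooth_functionals" "\<And>u. u \<in> U \<Longrightarrow> \<psi> u = 0" "\<psi> w \<noteq> 0"
        using summand_supporting_functional[OF fd sum uw(2)] by blast
      then have "\<psi> \<noteq> \<phi>" "\<psi> \<noteq> (\<lambda>x. - \<phi> x)" using \<phi>(2)[OF uw(2)] by auto
      then have "\<psi> e = 0" using \<psi>e \<psi>(1) by blast
      then show False using \<psi> uw by (simp add: linear_add[OF lin'[OF \<psi>(1)]])
    qed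
    then show ?thesis using uw by simp
  qed
  define U' where "U' = {u \<in> U. \<phi> u = 0}"
  define W' where "W' = {w + t *\<^sub>R e | w t. w \<in> W}"
  have nU': "norm (u + t *\<^sub>R e) = max (norm u) \<bar>t\<bar>" if u: "u \<in> U'" for u t
  proof (rule antisym)
    have \<phi>ut: "\<phi> (u + t *\<^sub>R e) = t" using u by (simp add: U'_def linear_add[OF lin] linear_scale[OF lin] \<phi>e)
    have same: "\<psi> (u + t *\<^sub>R e) = \<psi> u" if "\<psi> \<in> smooth_functionals" "\<psi> \<noteq> \<phi>" "\<psi> \<noteq> (\<lambda>x. - \<phi> x)" for \<psi>
      by (simp add: linear_add[OF lin'[OF that(1)]] linear_scale[OF lin'[OF that(1)]] \<psi>e[OF that])
    have le: "\<psi> x \<le> norm x" if "\<psi> \<in> smooth_functionals" for \<psi> and x :: 'a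
      using that smooth_at_le_norm by (auto simp: smooth_functionals_def)
    show "norm (u + t *\<^sub>R e) \<le> max (norm u) \<bar>t\<bar>"
    proof (rule norm_le_if_smooth_functionals_le[OF fd])
      fix \<psi> assume \<psi>: "\<psi> \<in> (smooth_functionals :: ('a \<Rightarrow> real) set)"
      show "\<psi> (u + t *\<^sub>R e) \<le> max (norm u) \<bar>t\<bar>"
      proof (cases "\<psi> = \<phi> \<or> \<psi> = (\<lambda>x. - \<phi> x)")
        case True then show ?thesis using \<phi>ut by auto
      next
        case False then show ?thesis using same[OF \<psi>] le[OF \<psi>, of u] by auto
      qed
    qed (simp add: le_max_iff_disj)
    have "norm u \<le> norm (u + t *\<^sub>R e)"
    proof (rule norm_le_if_smooth_functionals_le[OF fd])
      fix \<psi> assume \<psi>: "\<psi> \<in> (smooth_functionals :: ('a \<Rightarrow> real) set)"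
      show "\<psi> u \<le> norm (u + t *\<^sub>R e)"
      proof (cases "\<psi> = \<phi> \<or> \<psi> = (\<lambda>x. - \<phi> x)")
        case True then show ?thesis using u by (auto simp: U'_def)
      next
        case False then show ?thesis using same[OF \<psi>] le[OF \<psi>, of "u + t *\<^sub>R e"] by auto
      qed
    qed simp
    moreover have "\<bar>t\<bar> \<le> norm (u + t *\<^sub>R e)" using smooth_at_abs_le_norm[OF v, of "u + t *\<^sub>R e"] \<phi>ut by simp
    ultimately show "max (norm u) \<bar>t\<bar> \<le> norm (u + t *\<^sub>R e)" by simp
  qed
  have "0 \<in> U'" using subspace_0[OF sU] by (simp add: U'_def linear_0[OF lin])
  then have ne: "norm (t *\<^sub>R e) = \<bar>t\<bar>" for t using nU'[of 0 t] by simp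
  have nW': "norm (w + t *\<^sub>R e) = max (norm w) \<bar>t\<bar>" if "w \<in> W" for w t
    using nrm[OF subspace_scale[OF sU eU] that, of t] unfolding ne
    by (simp only: add.commute max.commute)
  have iso: "isometric_linf W' (Suc d)"
    unfolding isometric_linf_def W'_def using linf_isometry_extend[OF T lin \<phi>(2) \<phi>e nW'] by blast
  have "max_direct_sum U' W'"
    unfolding max_direct_sum_def
  proof (intro conjI allI ballI)
    show "subspace U'"
      using sU by (auto simp: U'_def subspace_def linear_0[OF lin] linear_add[OF lin] linear_scale[OF lin])
    show "subspace W'" using iso by (auto simp: isometric_linf_def linf_isometry_def)
    show "U' \<inter> W' = {0}"
    proof
      show "U' \<inter> W' \<subseteq> {0}"
      proof
        fix x assume x: "x \<in> U' \<inter> W'"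
        then obtain w t where w: "w \<in> W" "x = w + t *\<^sub>R e" by (auto simp: W'_def)
        have "w = x - t *\<^sub>R e" using w(2) by simp
        then have "w \<in> U" using x sU eU by (simp add: U'_def subspace_diff subspace_scale)
        then have "w = 0" using w(1) UW by auto
        moreover have "t = 0" using x w \<phi>(2) by (simp add: U'_def linear_add[OF lin] linear_scale[OF lin] \<phi>e)
        ultimately show "x \<in> {0}" using w by simp
      qed
      show "{0} \<subseteq> U' \<inter> W'"
        using \<open>0 \<in> U'\<close> \<open>subspace W'\<close> subspace_0 by auto
    qed
    show "\<exists>u\<in>U'. \<exists>w\<in>W'. x = u + w" for x
    proof -
      obtain u w where uw: "u \<in> U" "w \<in> W" "x = u + w" using dec by blast
      have "u - \<phi> u *\<^sub>R e \<in> U'"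
        using uw(1) sU eU by (simp add: U'_def subspace_diff subspace_scale linear_diff[OF lin] linear_scale[OF lin] \<phi>e)
      moreover have "w + \<phi> u *\<^sub>R e \<in> W'" using uw(2) by (auto simp: W'_def)
      moreover have "x = (u - \<phi> u *\<^sub>R e) + (w + \<phi> u *\<^sub>R e)" using uw(3) by simp
      ultimately show ?thesis by blast
    qed
    fix u x assume u: "u \<in> U'" and "x \<in> W'"
    then obtain w t where w: "w \<in> W" "x = w + t *\<^sub>R e" by (auto simp: W'_def)
    have "u + t *\<^sub>R e \<in> U" using u sU eU by (simp add: U'_def subspace_add subspace_scale)
    then have "norm ((u + t *\<^sub>R e) + w) = max (norm (u + t *\<^sub>R e)) (norm w)" using nrm w(1) by blast
    moreover have "u + x = (u + t *\<^sub>R e) + w" using w(2) by simp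
    ultimately have nux: "norm (u + x) = max (max (norm u) \<bar>t\<bar>) (norm w)"
      unfolding nU'[OF u] by (simp only:)
    have nx: "norm x = max (norm w) \<bar>t\<bar>" unfolding w(2) by (rule nW'[OF w(1)])
    show "norm (u + x) = max (norm u) (norm x)"
      unfolding nux nx by (simp add: max_def)
  qed
  then have "linf_summand W'" using iso by (auto simp: linf_summand_def)
  moreover have "W \<subseteq> W'" unfolding W'_def by (force intro: exI[of _ 0])
  moreover have "e \<in> W'" using subspace_0[OF sW] unfolding W'_def by (force intro: exI[of _ 1])
  moreover have "e \<notin> W" using \<phi>(2)[of e] \<phi>e by auto
  ultimately show ?thesis by blast
qed

section \<open>Step maps of a generic set are rigid\<close>

text \<open>
  Maximality of \<open>W\<close> makes \<open>step_map_functional_translation\<close> applicable to every smooth \<open>\<phi>\<close> vanishing on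
  \<open>W\<close>. On the fixed points it says that \<open>\<phi> \<circ> T\<inverse>\<close> and \<open>\<phi>\<close> agree on differences of points of \<open>A\<close>, hence
  on all differences of points of \<open>S\<close>; then \<open>\<phi> (k x) = \<phi> x\<close>.
\<close>

lemma step_map_fixing_frame_moves_along_summand:
  fixes S :: "'a::real_normed_vector set"
  assumes fd: "\<exists>B :: 'a set. finite B \<and> span B = UNIV"
    and decomp: "linf_decomposition U W d T0"
    and dense: "closure S = UNIV" and r: "r > 0" and step: "step_map r S k"
    and A: "A \<subseteq> S" "a0 \<in> A" "\<And>s. s \<in> S \<Longrightarrow> s - a0 \<in> span ((\<lambda>a. a - a0) ` A)"
    and fixed: "\<And>a. a \<in> A \<Longrightarrow> k a = a"
    and x: "x \<in> S"
  shows "k x - x \<in> W"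
proof -
  have sum: "max_direct_sum U W" and T0: "linf_isometry T0 W d"
    and maxW: "\<And>W'. linf_summand W' \<Longrightarrow> W \<subseteq> W' \<Longrightarrow> W' = W"
    using decomp by (auto simp: linf_decomposition_def)
  obtain T where T: "asymptotic_to S k T" "linear T" "bij T" "\<And>x. norm (T x) = norm x"
    using asymptotic_linear_isometry[OF fd dense r step] by blast
  have kx: "k x \<in> S" using step x by (auto simp: step_map_def bij_betw_def)
  have a0: "a0 \<in> S" using A by auto
  have invT: "inv T (T y) = y" "T (inv T y) = y" for y
    using T(3) by (simp_all add: bij_is_inj bij_is_surj surj_f_inv_f)
  have linI: "linear (inv T)"
    by (rule linearI) (metis invT linear_add[OF T(2)], metis invT linear_scale[OF T(2)])
  have "\<phi> (k x - x) = 0" if \<phi>: "\<phi> \<in> smooth_functionals" "\<And>w. w \<in> W \<Longrightarrow> \<phi> w = 0" for \<phi>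
  proof -
    have lin: "linear \<phi>" using \<phi>(1) smooth_at_linear by (auto simp: smooth_functionals_def)
    have ker: "\<phi> z = 0"
      if zero: "\<And>\<psi>. \<psi> \<in> smooth_functionals \<Longrightarrow> \<psi> \<noteq> \<phi> \<Longrightarrow> \<psi> \<noteq> (\<lambda>x. - \<phi> x) \<Longrightarrow> \<psi> z = 0" for z
    proof (rule ccontr)
      assume nz: "\<phi> z \<noteq> 0"
      have "\<exists>W'. linf_summand W' \<and> W \<subset> W'"
      proof (rule isolated_functional_enlarges_summand[OF fd sum T0 \<phi> nz])
        fix \<psi> assume "\<psi> \<in> smooth_functionals" "\<psi> \<noteq> \<phi>" "\<psi> \<noteq> (\<lambda>x. - \<phi> x)"
        then show "\<psi> z = 0" by (rule zero)
      qed
      then show False using maxW by blast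
    qed
    note transl = step_map_functional_translation[OF fd dense r step T \<phi>(1) ker]
    define D where "D y = \<phi> (inv T y) - \<phi> y" for y
    have linD: "linear D"
      unfolding D_def
      by (rule linearI) (simp_all add: linear_add[OF lin] linear_add[OF linI] linear_scale[OF lin]
          linear_scale[OF linI] algebra_simps)
    have "D (a - a0) = 0" if "a \<in> A" for a
      using transl[of a a0] A that fixed by (auto simp: D_def linear_diff[OF lin] linear_diff[OF linI])
    then have "D y = 0" if "y \<in> span ((\<lambda>a. a - a0) ` A)" for y
      using linear_eq_0_on_span[OF linD, of "(\<lambda>a. a - a0) ` A" y] that by blast
    then have "D (k x - a0) = 0" using A(3)[OF kx] by blast
    moreover have "\<phi> (inv T (k x)) - \<phi> (inv T (k a0)) = \<phi> x - \<phi> a0" by (rule transl[OF _ x a0])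
    ultimately show ?thesis
      using fixed[OF A(2)] by (simp add: D_def linear_diff[OF lin] linear_diff[OF linI])
  qed
  moreover obtain u w where uw: "u \<in> U" "w \<in> W" "k x - x = u + w"
    using sum by (meson max_direct_sum_def)
  ultimately have "\<phi> u = 0" if "\<phi> \<in> smooth_functionals" "\<And>w. w \<in> W \<Longrightarrow> \<phi> w = 0" for \<phi>
    using that smooth_at_linear linear_add[of \<phi> u w] by (fastforce simp: smooth_functionals_def)
  then have "u = 0"
    using summand_supporting_functional[OF fd max_direct_sum_commute[OF sum] uw(1)] by blast
  then show ?thesis using uw by simp
qed

text \<open>
  This is where genericity enters: a move along \<open>W\<close> does not change the \<open>U\<close>-component, and points of \<open>S\<close>
  with the same \<open>U\<close>-component coincide, provided that \<open>U\<close> is nonzero.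
\<close>

lemma step_map_determined_on_finite_set:
  fixes S :: "'a::real_normed_vector set"
  assumes fd: "\<exists>B :: 'a set. finite B \<and> span B = UNIV"
    and notlinf: "\<forall>d. \<not> isometric_linf (UNIV :: 'a set) d"
    and dense: "closure S = UNIV" and gen: "generic S" and r: "r > 0"
  obtains A where "finite A" "A \<subseteq> S"
    "\<And>k x. step_map r S k \<Longrightarrow> (\<And>a. a \<in> A \<Longrightarrow> k a = a) \<Longrightarrow> x \<in> S \<Longrightarrow> k x = x"
proof -
  obtain U W d T0 where decomp: "linf_decomposition U W d T0"
    and gen': "\<forall>x\<in>S. \<forall>y\<in>S. x \<noteq> y \<longrightarrow>
      (\<forall>u\<in>U. \<forall>w\<in>W. \<forall>u'\<in>U. \<forall>w'\<in>W. x = u + w \<and> y = u' + w' \<longrightarrow>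
         (U \<noteq> {0} \<longrightarrow> u \<noteq> u') \<and> (\<forall>i<d. T0 w i - T0 w' i \<notin> \<int>))"
    using gen unfolding generic_def by (elim exE conjE)
  have sep: "u \<noteq> u'" if "x \<in> S" "y \<in> S" "x \<noteq> y" "u \<in> U" "w \<in> W" "u' \<in> U" "w' \<in> W"
    "x = u + w" "y = u' + w'" "U \<noteq> {0}" for x y u w u' w'
    using gen'[rule_format, OF that(1-7)] that(8-10) by simp
  have sum: "max_direct_sum U W" and iso: "isometric_linf W d"
    using decomp by (auto simp: linf_decomposition_def isometric_linf_def)
  have sU: "subspace U" and sW: "subspace W" and UW: "U \<inter> W = {0}" and dec: "\<And>x. \<exists>u\<in>U. \<exists>w\<in>W. x = u + w"
    using sum by (auto simp: max_direct_sum_def)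
  have U: "U \<noteq> {0}"
  proof
    assume "U = {0}"
    then have "W = UNIV" using dec by auto
    then show False using iso notlinf by blast
  qed
  obtain a0 where a0: "a0 \<in> S" using dense_approx[OF dense, of 1] by auto
  obtain B where B: "B \<subseteq> (\<lambda>s. s - a0) ` S" "independent B" "(\<lambda>s. s - a0) ` S \<subseteq> span B"
    using maximal_independent_subset by blast
  have "finite B" using fd independent_span_bound[OF _ B(2)] by (metis subset_UNIV)
  define A where "A = insert a0 ((\<lambda>b. b + a0) ` B)"
  have "finite A" "A \<subseteq> S" using \<open>finite B\<close> a0 B(1) by (auto simp: A_def)
  moreover have "B \<subseteq> (\<lambda>a. a - a0) ` A" by (force simp: A_def)
  then have frame: "s - a0 \<in> span ((\<lambda>a. a - a0) ` A)" if "s \<in> S" for s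
    using B(3) that span_mono by blast
  have "k x = x" if k: "step_map r S k" "\<And>a. a \<in> A \<Longrightarrow> k a = a" "x \<in> S" for k x
  proof (rule ccontr)
    assume neq: "k x \<noteq> x"
    have kx: "k x \<in> S" using k(1,3) by (auto simp: step_map_def bij_betw_def)
    have W: "k x - x \<in> W"
      by (rule step_map_fixing_frame_moves_along_summand[OF fd decomp dense r k(1) \<open>A \<subseteq> S\<close> _ frame k(2,3)])
         (simp_all add: A_def)
    obtain u w where uw: "u \<in> U" "w \<in> W" "x = u + w" using dec by blast
    have "k x = u + (w + (k x - x))" using uw(3) by simp
    moreover have "w + (k x - x) \<in> W" using sW uw(2) W by (simp add: subspace_add)
    ultimately show False using sep[OF kx k(3) neq uw(1) _ uw(1,2) _ uw(3) U] by blast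
  qed
  ultimately show ?thesis using that by blast
qed

lemma countable_step_maps:
  fixes S :: "'a::real_normed_vector set"
  assumes fd: "\<exists>B :: 'a set. finite B \<and> span B = UNIV"
    and notlinf: "\<forall>d. \<not> isometric_linf (UNIV :: 'a set) d"
    and S: "countable S" and dense: "closure S = UNIV" and gen: "generic S" and r: "r > 0"
  shows "countable {f \<in> extensional S. step_map r S f}"
proof -
  obtain A where A: "finite A" "A \<subseteq> S" and
    rigid: "\<And>k x. step_map r S k \<Longrightarrow> (\<And>a. a \<in> A \<Longrightarrow> k a = a) \<Longrightarrow> x \<in> S \<Longrightarrow> k x = x"
    using step_map_determined_on_finite_set[OF fd notlinf dense gen r] by blast
  define Q where "Q = {f \<in> extensional S. step_map r S f}"
  have "inj_on (\<lambda>f. restrict f A) Q"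
  proof (rule inj_onI)
    fix f g assume f: "f \<in> Q" and g: "g \<in> Q" and eq: "restrict f A = restrict g A"
    have sf: "step_map r S f" and sg: "step_map r S g" using f g by (auto simp: Q_def)
    have bg: "bij_betw g S S" and bf: "bij_betw f S S" using sf sg by (auto simp: step_map_def)
    have "f a = g a" if "a \<in> A" for a using eq that by (metis restrict_apply')
    then have "(inv_into S g \<circ> f) a = a" if "a \<in> A" for a
      using that A(2) bij_betw_inv_into_left[OF bg] by auto
    then have fixed: "(inv_into S g \<circ> f) x = x" if "x \<in> S" for x
      using rigid[OF step_map_comp[OF sf step_map_inv_into[OF sg]] _ that] by blast
    have "f x = g x" if x: "x \<in> S" for x
    proof -
      have "f x \<in> S" using bf x by (rule bij_betw_apply)
      then have "g (inv_into S g (f x)) = f x" by (rule bij_betw_inv_into_right[OF bg])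
      then show ?thesis using fixed[OF x] by simp
    qed
    then show "f = g" using f g by (intro extensionalityI[of f S g]) (auto simp: Q_def)
  qed
  moreover have "restrict f A \<in> PiE A (\<lambda>_. S)" if "f \<in> Q" for f
    using that A(2) bij_betw_apply[of f S S] by (simp add: Q_def step_map_def subset_iff)
  then have "(\<lambda>f. restrict f A) ` Q \<subseteq> PiE A (\<lambda>_. S)" by blast
  then have "countable ((\<lambda>f. restrict f A) ` Q)"
    using countable_PiE[OF A(1), of "\<lambda>_. S"] S countable_subset by blast
  ultimately show ?thesis using countable_image_inj_on unfolding Q_def by blast
qed

section \<open>Almost sure properties of the random graphs\<close>

lemma (in product_prob_space) indep_vars_coordinates:
  assumes "I \<noteq> {}" shows "P.indep_vars M (\<lambda>i \<omega>. \<omega> i) I"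
proof (rule P.indep_vars_iff_distr_eq_PiM'[THEN iffD2])
  show "I \<noteq> {}" by fact
  show "(\<lambda>\<omega>. \<omega> i) \<in> measurable (PiM I M) (M i)" if "i \<in> I" for i
    using that by simp
  have "distr (PiM I M) (PiM I M) (\<lambda>\<omega>. \<lambda>i\<in>I. \<omega> i) = distr (PiM I M) (PiM I M) (\<lambda>\<omega>. \<omega>)"
    by (intro distr_cong) (auto simp: space_PiM PiE_def extensional_restrict)
  also have "\<dots> = PiM I M" by (rule distr_id)
  also have "\<dots> = PiM I (\<lambda>i. distr (PiM I M) (M i) (\<lambda>\<omega>. \<omega> i))"
    by (intro PiM_cong refl PiM_component[symmetric])
  finally show "distr (PiM I M) (PiM I M) (\<lambda>\<omega>. \<lambda>i\<in>I. \<omega> i) = PiM I (\<lambda>i. distr (PiM I M) (M i) (\<lambda>\<omega>. \<omega> i))" .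
qed

text \<open>
  Infinitely many disjoint blocks of bounded size match the pattern \<open>b\<close> independently, each with a
  probability bounded away from 0. Used with blocks of two edges, for common neighbours, and with
  single edges, for fixed bijections.
\<close>

lemma AE_bernoulli_product_block_matches:
  fixes b :: "'i \<Rightarrow> bool" and K :: "'j \<Rightarrow> 'i set"
  assumes p: "0 < p" "p < 1" and L: "infinite L" and disj: "disjoint_family_on K L"
    and K: "\<And>j. j \<in> L \<Longrightarrow> K j \<subseteq> I" "\<And>j. j \<in> L \<Longrightarrow> finite (K j)" "\<And>j. j \<in> L \<Longrightarrow> card (K j) \<le> m"
  shows "AE \<omega> in PiM I (\<lambda>_. measure_pmf (bernoulli_pmf p)). \<exists>j\<in>L. \<forall>i\<in>K j. \<omega> i = b i"
proof (cases "\<exists>j\<in>L. K j = {}")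
  case False
  define M where "M = (\<lambda>_::'i. measure_pmf (bernoulli_pmf p))"
  interpret product_prob_space M I
    unfolding M_def by unfold_locales
  define q where "q = min p (1 - p)"
  have q: "0 < q" "q < 1" using p by (auto simp: q_def)
  have "I \<noteq> {}" using False K(1) L by (metis finite.emptyI subset_empty ex_in_conv)
  define Y where "Y j \<omega> = restrict \<omega> (K j)" for j and \<omega> :: "'i \<Rightarrow> bool"
  have indep: "P.indep_vars (\<lambda>j. PiM (K j) M) Y L"
    using P.indep_vars_restrict[OF indep_vars_coordinates[OF \<open>I \<noteq> {}\<close>] K(1) disj]
    by (simp add: Y_def[abs_def])
  define B where "B j = space (PiM (K j) M) - PiE (K j) (\<lambda>i. {b i})" for j
  have B: "B j \<in> sets (PiM (K j) M)" if "j \<in> L" for j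
    unfolding B_def by (intro sets.compl_sets sets_PiM_I_finite K(2) that) (auto simp: M_def)
  have meas: "Y j -` B j \<inter> space (PiM I M) \<in> sets (PiM I M)" if "j \<in> L" for j
    by (rule measurable_sets[OF _ B[OF that]]) (use indep that in \<open>auto simp: P.indep_vars_def\<close>)
  have block: "P.prob (Y j -` B j \<inter> space (PiM I M)) \<le> 1 - q ^ m" if j: "j \<in> L" for j
  proof -
    define A where "A = emb I (K j) (PiE (K j) (\<lambda>i. {b i}))"
    have A: "A \<in> sets (PiM I M)"
      unfolding A_def by (intro sets_PiM_I K j) (auto simp: M_def)
    have "q ^ m \<le> q ^ card (K j)" using q K(3)[OF j] by (intro power_decreasing) auto
    also have "\<dots> = (\<Prod>i\<in>K j. q)" by simp
    also have "\<dots> \<le> (\<Prod>i\<in>K j. measure (M i) {b i})"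
    proof (intro prod_mono conjI)
      fix i show "q \<le> measure (M i) {b i}"
        using p by (cases "b i") (simp_all add: M_def q_def measure_pmf_single)
    qed (use q in simp)
    also have "\<dots> = P.prob A"
      unfolding A_def by (subst measure_PiM_emb) (use K j in \<open>auto simp: M_def\<close>)
    finally have "P.prob (space (PiM I M) - A) \<le> 1 - q ^ m" using A by (simp add: P.prob_compl)
    moreover have "Y j -` B j \<inter> space (PiM I M) \<subseteq> space (PiM I M) - A"
      using K(1)[OF j] by (auto simp: Y_def B_def A_def prod_emb_def)
    ultimately show ?thesis using P.finite_measure_mono[of _ "space (PiM I M) - A"] A
      by (meson order_trans sets.compl_sets)
  qed
  obtain g :: "nat \<Rightarrow> 'j" where g: "inj g" "range g \<subseteq> L" using infinite_countable_subset[OF L] by blast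
  define N where "N = (\<Inter>n. Y (g n) -` B (g n) \<inter> space (PiM I M))"
  have N: "N \<in> sets (PiM I M)" unfolding N_def using meas g(2) by (intro sets.countable_INT) auto
  have le: "P.prob N \<le> (1 - q ^ m) ^ Suc n" for n
  proof -
    define J where "J = g ` {..n}"
    have J: "J \<noteq> {}" "finite J" "J \<subseteq> L" using g(2) by (auto simp: J_def)
    have "N \<subseteq> (\<Inter>j\<in>J. Y j -` B j \<inter> space (PiM I M))" by (auto simp: N_def J_def)
    moreover have "(\<Inter>j\<in>J. Y j -` B j \<inter> space (PiM I M)) \<in> sets (PiM I M)"
      using J meas by (intro sets.finite_INT) auto
    ultimately have "P.prob N \<le> P.prob (\<Inter>j\<in>J. Y j -` B j \<inter> space (PiM I M))"
      by (rule P.finite_measure_mono)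
    also have "\<dots> = (\<Prod>j\<in>J. P.prob (Y j -` B j \<inter> space (PiM I M)))"
      using J B by (intro P.indep_varsD[OF indep]) auto
    also have "\<dots> \<le> (\<Prod>j\<in>J. 1 - q ^ m)"
      using block J(3) by (intro prod_mono) auto
    also have "\<dots> = (1 - q ^ m) ^ Suc n"
      using g(1) by (simp add: J_def card_image inj_on_subset)
    finally show ?thesis .
  qed
  have "0 < q ^ m" "q ^ m \<le> 1" using q by (simp_all add: power_le_one)
  then have "(\<lambda>n. (1 - q ^ m) ^ Suc n) \<longlonglongrightarrow> 0"
    by (intro LIMSEQ_Suc LIMSEQ_power_zero) auto
  then have "P.prob N \<le> 0" using le by (intro LIMSEQ_le_const) auto
  then have "emeasure (PiM I M) N = 0" by (simp add: P.emeasure_eq_measure measure_le_0_iff)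
  then have "AE \<omega> in PiM I M. \<omega> \<notin> N" using N by (intro AE_not_in) auto
  then have "AE \<omega> in PiM I M. \<exists>j\<in>L. \<forall>i\<in>K j. \<omega> i = b i"
    using AE_space
  proof eventually_elim
    case (elim \<omega>)
    then obtain n where "Y (g n) \<omega> \<notin> B (g n)" by (auto simp: N_def)
    moreover have "Y (g n) \<omega> \<in> space (PiM (K (g n)) M)" by (auto simp: Y_def space_PiM M_def)
    ultimately have "\<forall>i\<in>K (g n). \<omega> i = b i" by (auto simp: B_def Y_def PiE_iff)
    then show ?case using g(2) by blast
  qed
  then show ?thesis unfolding M_def .
qed auto

lemma countable_geometric_edges: "countable S \<Longrightarrow> countable (geometric_edges S)"
proof -
  assume "countable S"
  then have "countable ((\<lambda>(x, y). {x, y}) ` (S \<times> S))" by simp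
  moreover have "geometric_edges S \<subseteq> (\<lambda>(x, y). {x, y}) ` (S \<times> S)" by (auto simp: geometric_edges_def)
  ultimately show ?thesis by (rule countable_subset[rotated])
qed

lemma dense_open_infinite:
  fixes S :: "'a::real_normed_vector set"
  assumes dense: "closure S = UNIV" and "(UNIV :: 'a set) \<noteq> {0}" and "open O'" "O' \<noteq> {}"
  shows "infinite (S \<inter> O')"
proof
  assume fin: "finite (S \<inter> O')"
  have "\<not> open {x}" for x :: 'a
  proof
    assume "open {x}"
    then obtain e where e: "e > 0" "ball x e \<subseteq> {x}" by (meson open_contains_ball singletonI)
    obtain v :: 'a where "v \<noteq> 0" using assms(2) by auto
    then have "x + (e / 2 / norm v) *\<^sub>R v \<in> ball x e" using e(1) by (simp add: dist_norm)
    then have "(e / 2 / norm v) *\<^sub>R v = 0" using e(2) by auto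
    then show False using \<open>v \<noteq> 0\<close> e(1) by simp
  qed
  have "open (O' - (S \<inter> O'))" using assms(3) fin by (intro open_Diff finite_imp_closed)
  then have "(O' - (S \<inter> O')) \<inter> closure S = {} \<longleftrightarrow> (O' - (S \<inter> O')) \<inter> S = {}"
    by (rule open_Int_closure_eq_empty)
  then have "O' \<subseteq> S \<inter> O'" using dense by auto
  then have "finite O'" using fin by (rule finite_subset)
  moreover obtain x where x: "x \<in> O'" using assms(4) by blast
  ultimately have "open (O' - (O' - {x}))" using assms(3) by (intro open_Diff finite_imp_closed) auto
  moreover have "O' - (O' - {x}) = {x}" using x by auto
  ultimately show False using \<open>\<not> open {x}\<close> by simp
qed

text \<open>
  Every point of \<open>S\<close> near the midpoint of \<open>x\<close> and \<open>y\<close> is a candidate, and different candidates use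
  different edges.
\<close>

lemma AE_common_neighbour:
  fixes S :: "'a::real_normed_vector set"
  assumes p: "0 < p" "p < 1" and dense: "closure S = UNIV" and nt: "(UNIV :: 'a set) \<noteq> {0}"
    and xy: "x \<in> S" "y \<in> S" "x \<noteq> y" "norm (x - y) < 2"
  shows "AE \<omega> in random_graph p S. \<exists>z\<in>S. {x, z} \<in> kept_edges S \<omega> \<and> {z, y} \<in> kept_edges S \<omega>"
proof -
  define Z where "Z = S \<inter> (ball x 1 \<inter> ball y 1) - {x, y}"
  have "(1/2) *\<^sub>R (x + y) \<in> ball x 1 \<inter> ball y 1"
  proof -
    have "x - (1/2) *\<^sub>R (x + y) = (1/2) *\<^sub>R (x - y)" "y - (1/2) *\<^sub>R (x + y) = (1/2) *\<^sub>R (y - x)"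
      by (simp_all add: algebra_simps flip: scaleR_add_left)
    then show ?thesis using xy(4) by (simp add: dist_norm norm_minus_commute)
  qed
  then have "infinite (S \<inter> (ball x 1 \<inter> ball y 1))"
    by (intro dense_open_infinite dense nt) auto
  then have Z: "infinite Z" unfolding Z_def by simp
  have edge: "{x, z} \<in> geometric_edges S" "{z, y} \<in> geometric_edges S" if "z \<in> Z" for z
    using that xy by (auto simp: Z_def geometric_edges_def dist_norm norm_minus_commute)
  have "AE \<omega> in random_graph p S. \<exists>z\<in>Z. \<forall>i\<in>{{x, z}, {z, y}}. \<omega> i = True"
    unfolding random_graph_def
  proof (rule AE_bernoulli_product_block_matches[OF p Z, where m = 2])
    show "disjoint_family_on (\<lambda>z. {{x, z}, {z, y}}) Z"
      unfolding disjoint_family_on_def using xy(3) by (auto simp: Z_def doubleton_eq_iff)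
  qed (use edge in \<open>auto simp: card_insert_if\<close>)
  then show ?thesis
  proof eventually_elim
    case (elim \<omega>)
    then obtain z where "z \<in> Z" "\<omega> {x, z}" "\<omega> {z, y}" by auto
    then show ?case using edge by (auto simp: kept_edges_def Z_def)
  qed
qed

lemma AE_pair_swap:
  assumes "prob_space M" and AE: "AE z in M \<Otimes>\<^sub>M M. P z"
  shows "AE z in M \<Otimes>\<^sub>M M. P (snd z, fst z)"
proof -
  interpret M: prob_space M by fact
  interpret MM: pair_prob_space M M ..
  have "AE z in distr (M \<Otimes>\<^sub>M M) (M \<Otimes>\<^sub>M M) (\<lambda>(x, y). (y, x)). P z"
    by (subst MM.distr_pair_swap[symmetric]) (rule AE)
  from AE_distrD[OF measurable_pair_swap' this] show ?thesis by (simp add: case_prod_beta)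
qed

text \<open>
  Given \<open>\<omega>'\<close>, the condition prescribes the value of \<open>\<omega>\<close> at each of infinitely many edges.
\<close>

lemma AE_not_isomorphism:
  fixes S :: "'a::real_normed_vector set"
  assumes p: "0 < p" "p < 1" and S: "countable S" and dense: "closure S = UNIV" and nt: "(UNIV :: 'a set) \<noteq> {0}"
  shows "AE (\<omega>, \<omega>') in random_graph p S \<Otimes>\<^sub>M random_graph p S.
    \<not> (\<forall>x\<in>S. \<forall>y\<in>S. {x, y} \<in> kept_edges S \<omega> \<longleftrightarrow> {f x, f y} \<in> kept_edges S \<omega>')"
proof -
  let ?R = "random_graph p S" and ?G = "geometric_edges S"
  interpret R: prob_space ?R unfolding random_graph_def by (intro prob_space_PiM prob_space_measure_pmf)
  interpret RR: pair_prob_space ?R ?R ..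
  have cG: "countable ?G" by (rule countable_geometric_edges[OF S])
  have infG: "infinite ?G"
  proof -
    obtain x where x: "x \<in> S" using dense_approx[OF dense, of 1] by auto
    have "infinite (S \<inter> ball x 1)" by (intro dense_open_infinite dense nt) auto
    then have "infinite (S \<inter> ball x 1 - {x})" by simp
    moreover have "inj_on (\<lambda>y. {x, y}) (S \<inter> ball x 1 - {x})" by (auto simp: inj_on_def doubleton_eq_iff)
    ultimately have "infinite ((\<lambda>y. {x, y}) ` (S \<inter> ball x 1 - {x}))" by (simp add: finite_image_iff)
    moreover have "(\<lambda>y. {x, y}) ` (S \<inter> ball x 1 - {x}) \<subseteq> ?G"
      unfolding geometric_edges_def using x by (fastforce simp: dist_norm)
    ultimately show ?thesis using finite_subset by blast
  qed
  have coord: "(\<lambda>\<omega>. \<omega> e) \<in> measurable ?R (count_space UNIV)" if "e \<in> ?G" for e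
  proof -
    have "(\<lambda>\<omega>. \<omega> e) \<in> measurable ?R (measure_pmf (bernoulli_pmf p))"
      unfolding random_graph_def using that by simp
    then show ?thesis by (simp cong: measurable_cong_sets)
  qed
  define Q where "Q = (\<lambda>(\<omega>, \<omega>'). \<exists>e\<in>?G. \<omega> e = (\<not> (f ` e \<in> ?G \<and> \<omega>' (f ` e))))"
  have "AE z in ?R \<Otimes>\<^sub>M ?R. Q (snd z, fst z)"
  proof (rule RR.AE_pair_measure)
    show "{z \<in> space (?R \<Otimes>\<^sub>M ?R). Q (snd z, fst z)} \<in> sets (?R \<Otimes>\<^sub>M ?R)"
      unfolding Q_def prod.case
    proof (rule sets.sets_Collect_countable_Ex'[OF _ cG])
      fix e assume e: "e \<in> ?G"
      have [measurable]: "Measurable.pred (?R \<Otimes>\<^sub>M ?R) (\<lambda>z. snd z e)"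
        using measurable_compose[OF measurable_snd coord[OF e]] .
      have [measurable]: "Measurable.pred (?R \<Otimes>\<^sub>M ?R) (\<lambda>z. f ` e \<in> ?G \<and> fst z (f ` e))"
        using measurable_compose[OF measurable_fst coord[of "f ` e"]] by (cases "f ` e \<in> ?G") auto
      have "Measurable.pred (?R \<Otimes>\<^sub>M ?R) (\<lambda>z. snd z e = (\<not> (f ` e \<in> ?G \<and> fst z (f ` e))))"
        by measurable
      then show "{z \<in> space (?R \<Otimes>\<^sub>M ?R). snd z e = (\<not> (f ` e \<in> ?G \<and> fst z (f ` e)))} \<in> sets (?R \<Otimes>\<^sub>M ?R)"
        by simp
    qed
    show "AE \<omega>' in ?R. AE \<omega> in ?R. Q (snd (\<omega>', \<omega>), fst (\<omega>', \<omega>))"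
    proof (rule AE_I2)
      fix \<omega>'
      have "AE \<omega> in ?R. \<exists>e\<in>?G. \<forall>i\<in>{e}. \<omega> i = (\<not> (f ` i \<in> ?G \<and> \<omega>' (f ` i)))"
        unfolding random_graph_def
        by (rule AE_bernoulli_product_block_matches[OF p infG, where m = 1])
          (auto simp: disjoint_family_on_def)
      then show "AE \<omega> in ?R. Q (snd (\<omega>', \<omega>), fst (\<omega>', \<omega>))" by (simp add: Q_def)
    qed
  qed
  from AE_pair_swap[OF R.prob_space_axioms this] have "AE z in ?R \<Otimes>\<^sub>M ?R. Q z" by simp
  then show ?thesis
  proof eventually_elim
    case (elim z)
    obtain \<omega> \<omega>' where z: "z = (\<omega>, \<omega>')" by (cases z)
    obtain e where e: "e \<in> ?G" "\<omega> e = (\<not> (f ` e \<in> ?G \<and> \<omega>' (f ` e)))"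
      using elim by (auto simp: Q_def z)
    obtain x y where "x \<in> S" "y \<in> S" "e = {x, y}" using e(1) by (auto simp: geometric_edges_def)
    then show ?case using e by (auto simp: z kept_edges_def)
  qed
qed

section \<open>Isomorphic random graphs are related by step maps\<close>

text \<open>
  Distance less than 2 is recognised by the graph: it means to be equal or to have a common neighbour.
\<close>

lemma isomorphism_is_step_map:
  fixes S :: "'a::real_normed_vector set"
  assumes f: "bij_betw f S S" and iso: "\<And>x y. x \<in> S \<Longrightarrow> y \<in> S \<Longrightarrow> {x, y} \<in> kept_edges S \<omega> \<longleftrightarrow> {f x, f y} \<in> kept_edges S \<omega>'"
    and nb: "\<And>x y. x \<in> S \<Longrightarrow> y \<in> S \<Longrightarrow> x \<noteq> y \<Longrightarrow> norm (x - y) < 2 \<Longrightarrow>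
      \<exists>z\<in>S. {x, z} \<in> kept_edges S \<omega> \<and> {z, y} \<in> kept_edges S \<omega>"
    and nb': "\<And>x y. x \<in> S \<Longrightarrow> y \<in> S \<Longrightarrow> x \<noteq> y \<Longrightarrow> norm (x - y) < 2 \<Longrightarrow>
      \<exists>z\<in>S. {x, z} \<in> kept_edges S \<omega>' \<and> {z, y} \<in> kept_edges S \<omega>'"
  shows "step_map 2 S f"
proof -
  have edge: "norm (x - y) < 1" if "{x, y} \<in> kept_edges S \<eta>" for x y \<eta>
    using that by (auto simp: kept_edges_def geometric_edges_def doubleton_eq_iff norm_minus_commute)
  have two: "norm (x - y) < 2" if "{x, z} \<in> kept_edges S \<eta>" "{z, y} \<in> kept_edges S \<eta>" for x y z \<eta>
    using edge[OF that(1)] edge[OF that(2)] norm_triangle_ineq[of "x - z" "z - y"] by simp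
  have fS: "f x \<in> S" if "x \<in> S" for x using f that by (auto simp: bij_betw_def)
  have inj: "f x = f y \<longleftrightarrow> x = y" if "x \<in> S" "y \<in> S" for x y
    using f that by (auto simp: bij_betw_def inj_on_def)
  have "norm (x - y) < 2 \<longleftrightarrow> norm (f x - f y) < 2" if xy: "x \<in> S" "y \<in> S" for x y
  proof (cases "x = y")
    case False
    show ?thesis
    proof
      assume "norm (x - y) < 2"
      then obtain z where "z \<in> S" "{x, z} \<in> kept_edges S \<omega>" "{z, y} \<in> kept_edges S \<omega>"
        using nb xy False by blast
      then show "norm (f x - f y) < 2" using iso xy two by blast
    next
      assume "norm (f x - f y) < 2"
      then obtain z' where z': "z' \<in> S" "{f x, z'} \<in> kept_edges S \<omega>'" "{z', f y} \<in> kept_edges S \<omega>'"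
        using nb'[OF fS fS] xy False inj by blast
      moreover obtain z where "z \<in> S" "z' = f z" using f z'(1) by (auto simp: bij_betw_def)
      ultimately show "norm (x - y) < 2" using iso xy two by blast
    qed
  qed simp
  then show ?thesis using f by (simp add: step_map_def)
qed

theorem theorem1:
  fixes p :: real
    and almost_every :: "('a::real_normed_vector set \<Rightarrow> bool) \<Rightarrow> bool"
  assumes "\<exists>B :: 'a set. finite B \<and> span B = UNIV"
    and "(UNIV :: 'a set) \<noteq> {0}"
    and "\<forall>d. \<not> isometric_linf (UNIV :: 'a set) d"
    and "0 < p" and "p < 1"
    and "almost_every_notion almost_every"
  shows "almost_every (\<lambda>S. strongly_non_Rado p S)"
proof -
  have main: "strongly_non_Rado p S"
    if S: "countable S" "closure S = (UNIV :: 'a set)" "generic S" for S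
  proof -
    let ?R = "random_graph p S"
    interpret R: prob_space ?R unfolding random_graph_def by (intro prob_space_PiM prob_space_measure_pmf)
    define Q where "Q = {f \<in> extensional S. step_map 2 S f}"
    have cQ: "countable Q"
      unfolding Q_def by (rule countable_step_maps[OF assms(1,3) S]) simp
    define nb where "nb \<omega> \<longleftrightarrow> (\<forall>x\<in>S. \<forall>y\<in>S. x \<noteq> y \<and> norm (x - y) < 2 \<longrightarrow>
      (\<exists>z\<in>S. {x, z} \<in> kept_edges S \<omega> \<and> {z, y} \<in> kept_edges S \<omega>))" for \<omega>
    have nb: "AE \<omega> in ?R. nb \<omega>"
      unfolding nb_def
      by (intro AE_ball_countable[THEN iffD2] S ballI AE_impI AE_common_neighbour assms) auto
    have nb1: "AE z in ?R \<Otimes>\<^sub>M ?R. nb (fst z)"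
    proof (rule AE_distrD[OF measurable_fst])
      show "AE \<omega> in distr (?R \<Otimes>\<^sub>M ?R) ?R fst. nb \<omega>"
        by (subst R.distr_pair_fst) (rule nb)
    qed
    have nb2: "AE z in ?R \<Otimes>\<^sub>M ?R. nb (snd z)"
      using AE_pair_swap[OF R.prob_space_axioms nb1] by simp
    have noiso: "AE z in ?R \<Otimes>\<^sub>M ?R. \<forall>f\<in>Q. \<not> (\<forall>x\<in>S. \<forall>y\<in>S. {x, y} \<in> kept_edges S (fst z) \<longleftrightarrow> {f x, f y} \<in> kept_edges S (snd z))"
      using AE_not_isomorphism[OF assms(4,5) S(1,2) assms(2)] cQ
      by (simp add: AE_ball_countable case_prod_beta)
    from nb1 nb2 noiso have "AE z in ?R \<Otimes>\<^sub>M ?R. \<not> graph_isomorphic S (kept_edges S (fst z)) S (kept_edges S (snd z))"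
    proof eventually_elim
      case (elim z)
      show ?case
      proof
        assume "graph_isomorphic S (kept_edges S (fst z)) S (kept_edges S (snd z))"
        then obtain f where f: "bij_betw f S S"
          "\<And>x y. x \<in> S \<Longrightarrow> y \<in> S \<Longrightarrow> {x, y} \<in> kept_edges S (fst z) \<longleftrightarrow> {f x, f y} \<in> kept_edges S (snd z)"
          unfolding graph_isomorphic_def by blast
        define g where "g = restrict f S"
        have g: "bij_betw g S S"
          "\<And>x y. x \<in> S \<Longrightarrow> y \<in> S \<Longrightarrow> {x, y} \<in> kept_edges S (fst z) \<longleftrightarrow> {g x, g y} \<in> kept_edges S (snd z)"
          using f by (simp_all add: g_def)
        have "step_map 2 S g"
          by (rule isomorphism_is_step_map[OF g]) (use elim(1,2) in \<open>auto simp: nb_def\<close>)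
        then have "g \<in> Q" by (simp add: Q_def g_def)
        then show False using elim(3) g(2) by blast
      qed
    qed
    then show ?thesis by (simp add: strongly_non_Rado_def case_prod_beta)
  qed
  have "almost_every generic"
    and "\<And>P Q. (\<And>S. countable S \<Longrightarrow> closure S = UNIV \<Longrightarrow> P S \<Longrightarrow> Q S) \<Longrightarrow> almost_every P \<Longrightarrow> almost_every Q"
    using assms(6) unfolding almost_every_notion_def by blast+
  then show ?thesis using main by blast
qed

end
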